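(* Let $\sigma_1,\dots,\sigma_N$ be mutually orthogonal density matrices on $\mathcal{H}$, $D=\dim\mathcal{H}$, with supports $s_1,\dots,s_N$, and suppose they are perfectly distinguishable by LOCC. Then for any unit vectors $|\psi_i\rangle\in s_i$ ($i=1,\dots,N$), $$N\le \frac{D}{\overline{1+R(|\psi_i\rangle)}}\le\frac{D}{\overline{2^{E_R(|\psi_i\rangle)}}}\le\frac{D}{\overline{2^{E_g(|\psi_i\rangle)}}}.$$ In particular this holds for unit vectors $|\Psi_i\rangle\in s_i$ chosen with $R(|\Psi_i\rangle)=\max_{|\psi\rangle\in s_i,\ \||\psi\rangle\|=1}R(|\psi\rangle)$ for each $i$.
   Context: $\mathcal{H}=\mathcal{H}_1\otimes\cdots\otimes\mathcal{H}_m$ is finite-dimensional and shared by $m$ parties. Perfect LOCC distinguishability: there is an LOCC-implementable POVM $\{\Pi_i\}$ with $\mathrm{Tr}(\Pi_i\sigma_j)=\delta_{ij}$. The support of a density matrix is the span of its eigenvectors with nonzero eigenvalues. A state is (fully) separable if it is a convex combination of product states $\rho^{(1)}\otimes\cdots\otimes\rho^{(m)}$; $\mathfrak{S}$ denotes the set of separable states. For a state $\sigma$, the global robustness of entanglement is $R_g(\sigma)=\min\{t\ge0:\exists$ a density matrix $\varrho$ with $(\sigma+t\varrho)/(1+t)\in\mathfrak{S}\}$, and for a pure state $R(|\psi\rangle):=R_g(|\psi\rangle\langle\psi|)$. The relative entropy of entanglement is $E_R(\sigma)=\min_{\omega\in\mathfrak{S}}\mathrm{Tr}\,\sigma(\log_2\sigma-\log_2\omega)$,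 and $E_R(|\psi\rangle):=E_R(|\psi\rangle\langle\psi|)$. The geometric measure of a pure state is $E_g(|\psi\rangle)=-\log_2\max|\langle\phi|\psi\rangle|^2$, the maximum over unit product vectors $|\phi\rangle=|\phi_1\rangle\otimes\cdots\otimes|\phi_m\rangle$. For numbers $x_1,\dots,x_N$, $\overline{x_i}=\frac1N\sum_{i=1}^N x_i$. *)

theory Defs
  imports "Jordan_Normal_Form.Matrix" "HOL-Library.Extended_Real"
begin

definition ipr :: "complex vec \<Rightarrow> complex vec \<Rightarrow> complex" where
  "ipr v w = (\<Sum>i<dim_vec w. cnj (v $ i) * w $ i)"

definition mtrace :: "complex mat \<Rightarrow> complex" where
  "mtrace A = (\<Sum>i<dim_row A. A $$ (i,i))"

definition adj :: "complex mat \<Rightarrow> complex mat" where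
  "adj A = mat (dim_col A) (dim_row A) (\<lambda>(i,j). cnj (A $$ (j,i)))"

definition outer :: "complex vec \<Rightarrow> complex mat" where
  "outer v = mat (dim_vec v) (dim_vec v) (\<lambda>(i,j). v $ i * cnj (v $ j))"

definition unit_vec_in :: "nat \<Rightarrow> complex vec \<Rightarrow> bool" where
  "unit_vec_in n v \<longleftrightarrow> v \<in> carrier_vec n \<and> ipr v v = 1"

definition psd :: "nat \<Rightarrow> complex mat \<Rightarrow> bool" where
  "psd n A \<longleftrightarrow> A \<in> carrier_mat n n \<and> adj A = A \<and>
     (\<forall>v\<in>carrier_vec n. Re (ipr v (A *\<^sub>v v)) \<ge> 0)"

definition density :: "nat \<Rightarrow> complex mat \<Rightarrow> bool" where
  "density n \<rho> \<longleftrightarrow> psd n \<rho> \<and> mtrace \<rho> = 1"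

definition lin_span :: "nat \<Rightarrow> complex vec set \<Rightarrow> complex vec set" where
  "lin_span n S = {v \<in> carrier_vec n. \<exists>(k::nat) c w. (\<forall>i<k. w i \<in> S) \<and>
                  v = vec n (\<lambda>a. \<Sum>i<k. c i * (w i $ a))}"

definition supp_mat :: "nat \<Rightarrow> complex mat \<Rightarrow> complex vec set" where
  "supp_mat n \<rho> = lin_span n {v \<in> carrier_vec n. v \<noteq> 0\<^sub>v n \<and>
                      (\<exists>l. l \<noteq> 0 \<and> \<rho> *\<^sub>v v = l \<cdot>\<^sub>v v)}"

section \<open>Multipartite structure: H = C^(ds!0) (x) ... (x) C^(ds!(m-1)), m = length ds\<close>

definition dimH :: "nat list \<Rightarrow> nat" where
  "dimH ds = prod_list ds"

text \<open>Local index of party l in a global (mixed-radix, Kronecker-ordered) index a.\<close>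
definition digit :: "nat list \<Rightarrow> nat \<Rightarrow> nat \<Rightarrow> nat" where
  "digit ds l a = (a div prod_list (drop (Suc l) ds)) mod (ds ! l)"

text \<open>I (x) ... (x) A (at party k) (x) ... (x) I\<close>
definition loc :: "nat list \<Rightarrow> nat \<Rightarrow> complex mat \<Rightarrow> complex mat" where
  "loc ds k A = mat (dimH ds) (dimH ds) (\<lambda>(a,b).
     if (\<forall>l<length ds. l \<noteq> k \<longrightarrow> digit ds l a = digit ds l b)
     then A $$ (digit ds k a, digit ds k b) else 0)"

text \<open>rho_0 (x) ... (x) rho_(m-1)\<close>
definition prod_mat :: "nat list \<Rightarrow> (nat \<Rightarrow> complex mat) \<Rightarrow> complex mat" where
  "prod_mat ds \<rho>s = mat (dimH ds) (dimH ds) (\<lambda>(a,b).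
     \<Prod>l<length ds. \<rho>s l $$ (digit ds l a, digit ds l b))"

text \<open>phi_0 (x) ... (x) phi_(m-1)\<close>
definition prod_vec :: "nat list \<Rightarrow> (nat \<Rightarrow> complex vec) \<Rightarrow> complex vec" where
  "prod_vec ds \<phi>s = vec (dimH ds) (\<lambda>a. \<Prod>l<length ds. \<phi>s l $ digit ds l a)"

definition separable :: "nat list \<Rightarrow> complex mat \<Rightarrow> bool" where
  "separable ds \<sigma> \<longleftrightarrow> (\<exists>(K::nat) p \<rho>s.
      (\<forall>j<K. p j \<ge> 0 \<and> (\<forall>l<length ds. density (ds ! l) (\<rho>s j l))) \<and>
      (\<Sum>j<K. p j) = 1 \<and>
      \<sigma> = mat (dimH ds) (dimH ds) (\<lambda>(a,b).
              \<Sum>j<K. complex_of_real (p j) * prod_mat ds (\<rho>s j) $$ (a,b)))"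

definition rob_g :: "nat list \<Rightarrow> complex mat \<Rightarrow> real" where
  "rob_g ds \<sigma> = Inf {t::real. t \<ge> 0 \<and> (\<exists>\<rho>. density (dimH ds) \<rho> \<and>
      separable ds (complex_of_real (1 / (1 + t)) \<cdot>\<^sub>m (\<sigma> + complex_of_real t \<cdot>\<^sub>m \<rho>)))}"

definition rob :: "nat list \<Rightarrow> complex vec \<Rightarrow> real" where
  "rob ds \<psi> = rob_g ds (outer \<psi>)"

definition eigdec :: "nat \<Rightarrow> complex mat \<Rightarrow> (nat \<Rightarrow> real) \<Rightarrow> (nat \<Rightarrow> complex vec) \<Rightarrow> bool" where
  "eigdec n A lam e \<longleftrightarrow> (\<forall>k<n. e k \<in> carrier_vec n) \<and>
     (\<forall>j<n. \<forall>k<n. ipr (e j) (e k) = (if j = k then 1 else 0)) \<and>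
     A = mat n n (\<lambda>(a,b). \<Sum>k<n. complex_of_real (lam k) * (e k $ a) * cnj (e k $ b))"

text \<open>Tr sigma (log2 sigma - log2 omega), computed from spectral decompositions,
  with 0 log 0 = 0 and value +infinity when supp sigma is not contained in supp omega.\<close>
definition rel_ent :: "nat \<Rightarrow> complex mat \<Rightarrow> complex mat \<Rightarrow> ereal" where
  "rel_ent n \<sigma> \<omega> = (SOME x. \<exists>a f lam e. eigdec n \<sigma> a f \<and> eigdec n \<omega> lam e \<and>
     x = (if \<exists>j<n. \<exists>k<n. a j \<noteq> 0 \<and> lam k = 0 \<and> ipr (f j) (e k) \<noteq> 0 then \<infinity>
          else ereal (\<Sum>j<n. \<Sum>k<n. if a j = 0 then 0 else
                 (cmod (ipr (f j) (e k)))\<^sup>2 * a j * (log 2 (a j) - log 2 (lam k)))))"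

definition E_R :: "nat list \<Rightarrow> complex mat \<Rightarrow> ereal" where
  "E_R ds \<sigma> = (INF \<omega>\<in>{\<omega>. density (dimH ds) \<omega> \<and> separable ds \<omega>}. rel_ent (dimH ds) \<sigma> \<omega>)"

definition E_R_pure :: "nat list \<Rightarrow> complex vec \<Rightarrow> ereal" where
  "E_R_pure ds \<psi> = E_R ds (outer \<psi>)"

definition E_g :: "nat list \<Rightarrow> complex vec \<Rightarrow> real" where
  "E_g ds \<psi> = - log 2 (Sup {(cmod (ipr (prod_vec ds \<phi>s) \<psi>))\<^sup>2 | \<phi>s.
                  \<forall>l<length ds. unit_vec_in (ds ! l) (\<phi>s l)})"

definition msum :: "nat \<Rightarrow> nat set \<Rightarrow> (nat \<Rightarrow> complex mat) \<Rightarrow> complex mat" where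
  "msum n S f = mat n n (\<lambda>(a,b). \<Sum>j\<in>S. f j $$ (a,b))"

text \<open>locc_povm ds n E: the effects E 0, ..., E (n-1) form a POVM implementable by LOCC.
  Rules: trivial measurement; a local instrument (Kraus operators K 0..K (J-1) on party k)
  whose classical outcome j selects the subsequent LOCC protocol F j; classical
  post-processing (coarse graining / relabelling) of outcomes.\<close>
inductive locc_povm :: "nat list \<Rightarrow> nat \<Rightarrow> (nat \<Rightarrow> complex mat) \<Rightarrow> bool" for ds where
  trivial: "locc_povm ds 1 (\<lambda>_. 1\<^sub>m (dimH ds))"
| local_step: "\<lbrakk> k < length ds; (J::nat) > 0;
     \<forall>j<J. K j \<in> carrier_mat (ds ! k) (ds ! k);
     msum (ds ! k) {..<J} (\<lambda>j. adj (K j) * K j) = 1\<^sub>m (ds ! k);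
     \<forall>j<J. locc_povm ds n (F j) \<rbrakk> \<Longrightarrow>
     locc_povm ds n (\<lambda>i. msum (dimH ds) {..<J} (\<lambda>j. adj (loc ds k (K j)) * F j i * loc ds k (K j)))"
| coarse: "\<lbrakk> locc_povm ds n E; \<forall>l<n. g l < n' \<rbrakk> \<Longrightarrow>
     locc_povm ds n' (\<lambda>i. msum (dimH ds) {l. l < n \<and> g l = i} E)"

definition locc_distinguishable :: "nat list \<Rightarrow> nat \<Rightarrow> (nat \<Rightarrow> complex mat) \<Rightarrow> bool" where
  "locc_distinguishable ds N \<sigma> \<longleftrightarrow> (\<exists>Pm. locc_povm ds N Pm \<and>
     (\<forall>i<N. \<forall>j<N. mtrace (Pm i * \<sigma> j) = (if i = j then 1 else 0)))"

definition avg :: "nat \<Rightarrow> (nat \<Rightarrow> real) \<Rightarrow> real" where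
  "avg N x = (\<Sum>i<N. x i) / real N"

end

(* An LOCC effect is a sum of products of positive semidefinite operators. An effect P that
   occurs with certainty in sigma fixes the support of sigma, so P - |psi><psi| is still positive
   semidefinite and P / Tr P is a separable mixture of |psi> with noise: hence 1 + R(psi) <= Tr P,
   and the traces of the effects add up to D. If (|psi><psi| + t rho) / (1 + t) = omega is separable,
   then <psi| omega^-1 |psi> <= 1 + t, so Jensen's inequality gives E_R <= log2 (1 + t). Jensen's
   inequality in the other direction gives Tr(|psi><psi| (log |psi><psi| - log omega)) >=
   -log2 <psi| omega |psi>, and for separable omega this overlap is at most the best overlap with
   a product vector. *)

theory Submission
  imports Defs "Jordan_Normal_Form.Spectral_Radius" "HOL-Library.FuncSet"
begin

section \<open>Inner product, spectral theorem\<close>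

text \<open>\<open>rob\<close> and \<open>E_g\<close> are built from an \<open>Inf\<close> and a
  \<open>Sup\<close> of real sets, \<open>E_R_pure\<close> is an \<open>ereal\<close> later turned
  into a real, and \<open>rel_ent\<close> selects an unknown spectral decomposition. So no optimum
  is assumed attained: bounds are proved for each feasible \<open>t\<close> and each separable
  state, and only then passed to the infimum. The LOCC effect has a second role here: it exhibits a
  feasible \<open>t\<close>, which gives \<open>Inf\<close> its meaning and shows that
  \<open>E_R_pure\<close> is finite. That an effect P fixes the support of sigma comes from M = 1 -
  P. This operator is positive because it is the sum of the other effects, and Tr (M sigma) = 0 then
  forces M sigma = 0. The inverse of omega is never formed as a matrix. In an eigenbasis of omega
  the convention \<open>inverse 0 = 0\<close> yields the pseudo-inverse, which suffices because a
  state dominated by a multiple of omega is orthogonal to the kernel of omega.\<close>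

lemma ipr_eq: "w \<in> carrier_vec n \<Longrightarrow> ipr v w = (\<Sum>i<n. cnj (v $ i) * w $ i)"
  by (auto simp: ipr_def)

lemma ipr_cnj: "v \<in> carrier_vec n \<Longrightarrow> w \<in> carrier_vec n \<Longrightarrow> cnj (ipr v w) = ipr w v"
  by (auto simp: ipr_def mult.commute)

lemma ipr_self:
  assumes "v \<in> carrier_vec n"
  shows "ipr v v = complex_of_real (\<Sum>i<n. (cmod (v $ i))\<^sup>2)"
  using assms by (simp add: ipr_def complex_norm_square mult.commute del: of_real_power)

lemma ipr_self_eq_0:
  assumes "v \<in> carrier_vec n" "ipr v v = 0"
  shows "v = 0\<^sub>v n"
proof -
  have "(\<Sum>i<n. (cmod (v $ i))\<^sup>2) = 0"
    using assms(2) unfolding ipr_self[OF assms(1)] of_real_eq_0_iff .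
  then have "\<forall>i<n. v $ i = 0"
    by (subst (asm) sum_nonneg_eq_0_iff) auto
  with assms(1) show ?thesis by auto
qed

text \<open>Same shape as the combinations inside \<open>lin_span\<close>, so that vectors of
  \<open>supp_mat\<close> and spectral expansions share one calculus.\<close>

definition lincomb :: "nat \<Rightarrow> nat \<Rightarrow> (nat \<Rightarrow> complex) \<Rightarrow> (nat \<Rightarrow> complex vec) \<Rightarrow> complex vec" where
  "lincomb n k c w = vec n (\<lambda>a. \<Sum>i<k. c i * w i $ a)"

lemma lincomb_carrier [simp]: "lincomb n k c w \<in> carrier_vec n"
  by (simp add: lincomb_def)

lemma lincomb_cong:
  assumes "\<And>i. i < k \<Longrightarrow> c i = c' i" "\<And>i. i < k \<Longrightarrow> w i = w' i"
  shows "lincomb n k c w = lincomb n k c' w'"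
  using assms by (auto simp: lincomb_def)

lemma ipr_lincomb_right:
  assumes "\<And>i. i < k \<Longrightarrow> w i \<in> carrier_vec n"
  shows "ipr v (lincomb n k c w) = (\<Sum>i<k. c i * ipr v (w i))"
proof -
  have "ipr v (lincomb n k c w) = (\<Sum>a<n. \<Sum>i<k. c i * (cnj (v $ a) * w i $ a))"
    by (subst ipr_eq[OF lincomb_carrier]) (simp add: lincomb_def sum_distrib_left mult_ac)
  also have "\<dots> = (\<Sum>i<k. \<Sum>a<n. c i * (cnj (v $ a) * w i $ a))" by (rule sum.swap)
  also have "\<dots> = (\<Sum>i<k. c i * ipr v (w i))"
    using assms by (intro sum.cong) (auto simp: ipr_eq[of _ n] sum_distrib_left)
  finally show ?thesis .
qed

lemma mult_mat_vec_index:
  assumes "A \<in> carrier_mat m n" "v \<in> carrier_vec n" "i < m"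
  shows "(A *\<^sub>v v) $ i = (\<Sum>j<n. A $$ (i,j) * v $ j)"
  using assms by (auto simp: scalar_prod_def atLeast0LessThan)

lemma mult_mat_index:
  assumes "A \<in> carrier_mat m n" "B \<in> carrier_mat n p" "i < m" "j < p"
  shows "(A * B) $$ (i,j) = (\<Sum>k<n. A $$ (i,k) * B $$ (k,j))"
  using assms by (auto simp: scalar_prod_def atLeast0LessThan)

lemma mult_mat_lincomb:
  assumes "A \<in> carrier_mat n n" "\<And>i. i < k \<Longrightarrow> w i \<in> carrier_vec n"
  shows "A *\<^sub>v lincomb n k c w = lincomb n k c (\<lambda>i. A *\<^sub>v w i)"
proof
  fix a assume "a < dim_vec (lincomb n k c (\<lambda>i. A *\<^sub>v w i))"
  then have a: "a < n" by (simp add: lincomb_def)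
  have "(A *\<^sub>v lincomb n k c w) $ a = (\<Sum>j<n. \<Sum>i<k. c i * (A $$ (a,j) * w i $ j))"
    using a assms by (simp add: mult_mat_vec_index[OF assms(1)] del: index_mult_mat_vec)
      (simp add: lincomb_def sum_distrib_left mult_ac)
  also have "\<dots> = (\<Sum>i<k. \<Sum>j<n. c i * (A $$ (a,j) * w i $ j))" by (rule sum.swap)
  also have "\<dots> = lincomb n k c (\<lambda>i. A *\<^sub>v w i) $ a"
    using a assms(2) by (simp add: lincomb_def mult_mat_vec_index[OF assms(1)] sum_distrib_left
        del: index_mult_mat_vec)
  finally show "(A *\<^sub>v lincomb n k c w) $ a = lincomb n k c (\<lambda>i. A *\<^sub>v w i) $ a" .
qed (use assms in \<open>auto simp: lincomb_def\<close>)

lemma adj_carrier [simp]: "A \<in> carrier_mat m n \<Longrightarrow> adj A \<in> carrier_mat n m"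
  by (auto simp: adj_def)

lemma ipr_adj:
  assumes "A \<in> carrier_mat n n" "v \<in> carrier_vec n" "w \<in> carrier_vec n"
  shows "ipr v (A *\<^sub>v w) = ipr (adj A *\<^sub>v v) w"
proof -
  have "ipr v (A *\<^sub>v w) = (\<Sum>i<n. \<Sum>j<n. cnj (v $ i) * A $$ (i,j) * w $ j)"
    using assms by (subst ipr_eq[of _ n])
     (auto simp: mult_mat_vec_index[OF assms(1)] sum_distrib_left mult_ac simp del: index_mult_mat_vec)
  also have "\<dots> = (\<Sum>j<n. \<Sum>i<n. cnj (v $ i) * A $$ (i,j) * w $ j)" by (rule sum.swap)
  also have "\<dots> = (\<Sum>j<n. cnj (\<Sum>i<n. adj A $$ (j,i) * v $ i) * w $ j)"
    using assms(1) by (simp add: adj_def sum_distrib_left mult_ac)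
  also have "\<dots> = ipr (adj A *\<^sub>v v) w"
    using assms by (subst ipr_eq[of _ n])
     (auto simp: mult_mat_vec_index[OF adj_carrier[OF assms(1)]] simp del: index_mult_mat_vec)
  finally show ?thesis .
qed

section \<open>Orthonormal families, completeness and eigenbases\<close>

definition orthonormal :: "nat \<Rightarrow> nat \<Rightarrow> (nat \<Rightarrow> complex vec) \<Rightarrow> bool" where
  "orthonormal n k e \<longleftrightarrow> (\<forall>i<k. e i \<in> carrier_vec n) \<and>
     (\<forall>i<k. \<forall>j<k. ipr (e i) (e j) = (if i = j then 1 else 0))"

lemma orthonormalD:
  assumes "orthonormal n k e" "i < k"
  shows "e i \<in> carrier_vec n" "j < k \<Longrightarrow> ipr (e i) (e j) = (if i = j then 1 else 0)"
  using assms by (auto simp: orthonormal_def)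

lemma sum_mult_delta:
  fixes f :: "nat \<Rightarrow> 'a::comm_semiring_1"
  shows "a < n \<Longrightarrow> (\<Sum>b<n. f b * (if a = b then 1 else 0)) = f a"
  by (simp add: if_distrib[of "\<lambda>x. _ * x"] cong: if_cong)

text \<open>Let \<open>U\<close> have the vectors \<open>e k\<close> as columns. Orthonormality says
  \<open>V * U = 1\<close> for the adjoint \<open>V\<close>; for square matrices this gives
  \<open>U * V = 1\<close>, which is the completeness relation.\<close>

lemma orthonormal_complete:
  assumes "orthonormal n n e" "a < n" "b < n"
  shows "(\<Sum>k<n. e k $ a * cnj (e k $ b)) = (if a = b then 1 else 0)"
proof -
  define U where "U = mat n n (\<lambda>(a,k). e k $ a)"
  define V where "V = mat n n (\<lambda>(k,a). cnj (e k $ a))"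
  have c: "U \<in> carrier_mat n n" "V \<in> carrier_mat n n" by (auto simp: U_def V_def)
  have "V * U = 1\<^sub>m n"
  proof
    fix i j assume "i < dim_row (1\<^sub>m n :: complex mat)" "j < dim_col (1\<^sub>m n :: complex mat)"
    then have ij: "i < n" "j < n" by auto
    have "(V * U) $$ (i,j) = (\<Sum>k<n. cnj (e i $ k) * e j $ k)"
      using ij by (simp add: mult_mat_index[OF c(2,1)] del: index_mult_mat(1)) (simp add: U_def V_def)
    also have "\<dots> = ipr (e i) (e j)"
      using orthonormalD(1)[OF assms(1)] ij by (simp add: ipr_eq[of _ n])
    finally show "(V * U) $$ (i,j) = 1\<^sub>m n $$ (i,j)"
      using ij orthonormalD(2)[OF assms(1)] by simp
  qed (use c in auto)
  from mat_mult_left_right_inverse[OF c(2,1) this] have "(U * V) $$ (a,b) = 1\<^sub>m n $$ (a,b)" by simp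
  then show ?thesis
    using assms(2,3) unfolding mult_mat_index[OF c assms(2,3)] by (simp add: U_def V_def)
qed

lemma orthonormal_expand:
  assumes "orthonormal n n e" "v \<in> carrier_vec n"
  shows "v = lincomb n n (\<lambda>k. ipr (e k) v) e"
proof
  fix a assume "a < dim_vec (lincomb n n (\<lambda>k. ipr (e k) v) e)"
  then have a: "a < n" by (simp add: lincomb_def)
  have "lincomb n n (\<lambda>k. ipr (e k) v) e $ a = (\<Sum>k<n. \<Sum>b<n. (e k $ a * cnj (e k $ b)) * v $ b)"
    using a assms by (simp add: lincomb_def ipr_eq[of _ n] sum_distrib_left sum_distrib_right mult_ac)
  also have "\<dots> = (\<Sum>b<n. \<Sum>k<n. (e k $ a * cnj (e k $ b)) * v $ b)" by (rule sum.swap)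
  also have "\<dots> = (\<Sum>b<n. (if a = b then 1 else 0) * v $ b)"
    using a by (intro sum.cong refl) (simp add: sum_distrib_right[symmetric] orthonormal_complete[OF assms(1)])
  also have "\<dots> = (\<Sum>b<n. if a = b then v $ b else 0)" by (intro sum.cong) auto
  also have "\<dots> = v $ a" using a by simp
  finally show "v $ a = lincomb n n (\<lambda>k. ipr (e k) v) e $ a" by simp
qed (use assms in \<open>auto simp: lincomb_def\<close>)

lemma orthonormal_eqI:
  assumes "orthonormal n n e" "v \<in> carrier_vec n" "w \<in> carrier_vec n"
    "\<And>k. k < n \<Longrightarrow> ipr (e k) v = ipr (e k) w"
  shows "v = w"
proof -
  have "v = lincomb n n (\<lambda>k. ipr (e k) v) e" by (rule orthonormal_expand[OF assms(1,2)])
  also have "\<dots> = lincomb n n (\<lambda>k. ipr (e k) w) e" by (rule lincomb_cong) (use assms(4) in auto)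
  also have "\<dots> = w" by (rule orthonormal_expand[OF assms(1,3), symmetric])
  finally show ?thesis .
qed

lemma parseval:
  assumes "orthonormal n n e" "v \<in> carrier_vec n"
  shows "(\<Sum>k<n. (cmod (ipr (e k) v))\<^sup>2) = Re (ipr v v)"
proof -
  have "ipr v v = ipr v (lincomb n n (\<lambda>k. ipr (e k) v) e)"
    using orthonormal_expand[OF assms] by simp
  also have "\<dots> = (\<Sum>k<n. ipr (e k) v * cnj (ipr (e k) v))"
    using assms orthonormalD[OF assms(1)] by (simp add: ipr_lincomb_right ipr_cnj[of _ n])
  also have "\<dots> = complex_of_real (\<Sum>k<n. (cmod (ipr (e k) v))\<^sup>2)"
    by (simp add: complex_norm_square del: of_real_power)
  finally show ?thesis by simp
qed

lemma ipr_smult_right: "v \<in> carrier_vec n \<Longrightarrow> w \<in> carrier_vec n \<Longrightarrow> ipr v (c \<cdot>\<^sub>v w) = c * ipr v w"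
  by (auto simp: ipr_def sum_distrib_left mult_ac)

lemma ipr_smult_left: "v \<in> carrier_vec n \<Longrightarrow> w \<in> carrier_vec n \<Longrightarrow> ipr (c \<cdot>\<^sub>v v) w = cnj c * ipr v w"
  by (auto simp: ipr_def sum_distrib_left mult_ac)

lemma exists_normalization:
  assumes "v \<in> carrier_vec n" "v \<noteq> 0\<^sub>v n"
  shows "\<exists>c. c \<noteq> 0 \<and> unit_vec_in n (c \<cdot>\<^sub>v v)"
proof -
  define r where "r = (\<Sum>i<n. (cmod (v $ i))\<^sup>2)"
  have r: "ipr v v = complex_of_real r" using ipr_self[OF assms(1)] by (simp add: r_def)
  have "r \<noteq> 0" using ipr_self_eq_0[OF assms(1)] assms(2) r by auto
  moreover have "r \<ge> 0" by (simp add: r_def sum_nonneg)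
  ultimately have r0: "r > 0" by simp
  define c where "c = complex_of_real (1 / sqrt r)"
  have "cnj c * c * complex_of_real r = complex_of_real (1 / sqrt r * (1 / sqrt r) * r)"
    by (simp only: c_def complex_cnj_complex_of_real of_real_mult)
  also have "1 / sqrt r * (1 / sqrt r) * r = 1" using r0 by (simp add: field_simps)
  finally have "ipr (c \<cdot>\<^sub>v v) (c \<cdot>\<^sub>v v) = 1"
    using assms(1) r by (simp add: ipr_smult_left[of _ n] ipr_smult_right[of _ n] mult_ac)
  then show ?thesis using r0 assms(1) by (intro exI[of _ c]) (auto simp: unit_vec_in_def c_def)
qed

text \<open>Since \<open>k < n\<close>, the conjugates of the given vectors fit as rows into a
  square matrix with row \<open>k\<close> left zero. It is singular, and a kernel vector is
  orthogonal to all \<open>e i\<close>.\<close>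

lemma orthonormal_extend1:
  assumes e: "orthonormal n k e" and k: "k < n"
  shows "\<exists>v. unit_vec_in n v \<and> (\<forall>i<k. ipr (e i) v = 0)"
proof -
  define M where "M = mat\<^sub>r n n (\<lambda>i. if i = k then 0\<^sub>v n else vec n (\<lambda>a. if i < k then cnj (e i $ a) else 0))"
  have M: "M \<in> carrier_mat n n" by (simp add: M_def)
  have "det M = 0" unfolding M_def by (rule det_row_0[OF k]) auto
  then obtain v where v: "v \<in> carrier_vec n" "v \<noteq> 0\<^sub>v n" "M *\<^sub>v v = 0\<^sub>v n"
    using det_0_iff_vec_prod_zero[OF M] by auto
  have Mi: "M $$ (i,a) = cnj (e i $ a)" if "i < k" "a < n" for i a
    using that k by (simp add: M_def)
  have orth: "ipr (e i) v = 0" if "i < k" for i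
  proof -
    have "ipr (e i) v = (M *\<^sub>v v) $ i"
      using that k v by (subst mult_mat_vec_index[OF M v(1)]) (auto simp: ipr_eq Mi)
    then show ?thesis using that k v by simp
  qed
  obtain c where "unit_vec_in n (c \<cdot>\<^sub>v v)" using exists_normalization[OF v(1,2)] by auto
  then show ?thesis using orth orthonormalD(1)[OF e] v
    by (intro exI[of _ "c \<cdot>\<^sub>v v"]) (auto simp: ipr_smult_right[of _ n])
qed

lemma orthonormal_snoc:
  assumes "orthonormal n k e" "unit_vec_in n v" "\<forall>i<k. ipr (e i) v = 0"
  shows "orthonormal n (Suc k) (e(k := v))"
proof -
  have "ipr v (e i) = 0" if "i < k" for i
    using ipr_cnj[of "e i" n v] orthonormalD(1)[OF assms(1) that] assms that by (auto simp: unit_vec_in_def)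
  then show ?thesis using assms by (auto simp: orthonormal_def unit_vec_in_def less_Suc_eq)
qed

text \<open>The induction runs downwards from \<open>n\<close>, where nothing is left to add: one
  new vector leads from \<open>m\<close> to the settled case \<open>Suc m\<close>.\<close>

lemma orthonormal_extend:
  assumes "k \<le> n" "orthonormal n k e"
  shows "\<exists>f. orthonormal n n f \<and> (\<forall>i<k. f i = e i)"
  using assms
proof (induction arbitrary: e rule: inc_induct)
  case (step m)
  obtain v where v: "unit_vec_in n v" "\<forall>i<m. ipr (e i) v = 0"
    using orthonormal_extend1[OF step.prems step.hyps(2)] by auto
  then obtain f where "orthonormal n n f" "\<forall>i<Suc m. f i = (e(m := v)) i"
    using step.IH[OF orthonormal_snoc[OF step.prems v]] by auto
  then show ?case by (intro exI[of _ f]) auto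
qed auto

text \<open>The orthogonal complement of the given eigenvectors is invariant; an eigenvector of the
  compression of \<open>A\<close> to it is an eigenvector of \<open>A\<close>.\<close>

lemma hermitian_next_eigenvector:
  assumes A: "A \<in> carrier_mat n n" "adj A = A" and e: "orthonormal n k e" and k: "k < n"
    and eig: "\<forall>i<k. A *\<^sub>v e i = l i \<cdot>\<^sub>v e i"
  shows "\<exists>v \<mu>. unit_vec_in n v \<and> (\<forall>i<k. ipr (e i) v = 0) \<and> A *\<^sub>v v = \<mu> \<cdot>\<^sub>v v"
proof -
  obtain f where f: "orthonormal n n f" and fe: "\<forall>i<k. f i = e i"
    using orthonormal_extend[OF less_imp_le[OF k] e] by auto
  define m where "m = n - k"
  define g where "g j = f (k + j)" for j
  have g: "g j \<in> carrier_vec n" if "j < m" for j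
    using that k orthonormalD(1)[OF f] by (auto simp: g_def m_def)
  have Ag: "A *\<^sub>v g j \<in> carrier_vec n" if "j < m" for j using g[OF that] A by auto
  have gg: "ipr (g i) (g j) = (if i = j then 1 else 0)" if "i < m" "j < m" for i j
    using that k orthonormalD(2)[OF f, of "k+i" "k+j"] by (auto simp: g_def m_def)
  define B where "B = mat m m (\<lambda>(i,j). ipr (g i) (A *\<^sub>v g j))"
  have B: "B \<in> carrier_mat m m" by (simp add: B_def)
  \<comment> \<open>The compression has size \<open>n - k\<close>, which is positive because
    \<open>k < n\<close>; only then is a spectrum guaranteed.\<close>
  have "spectrum B \<noteq> {}" using spectrum_non_empty[OF B] k by (auto simp: m_def)
  then obtain \<mu> y where y: "eigenvector B y \<mu>" by (auto simp: spectrum_def eigenvalue_def)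
  then have y: "y \<in> carrier_vec m" "y \<noteq> 0\<^sub>v m" "B *\<^sub>v y = \<mu> \<cdot>\<^sub>v y"
    using B by (auto simp: eigenvector_def)
  define v where "v = lincomb n m (\<lambda>j. y $ j) g"
  have v: "v \<in> carrier_vec n" by (simp add: v_def)
  have gv: "ipr (g i) v = y $ i" if "i < m" for i
  proof -
    have "ipr (g i) v = (\<Sum>j<m. y $ j * (if i = j then 1 else 0))"
      unfolding v_def using that by (subst ipr_lincomb_right) (auto simp: g gg)
    then show ?thesis using that by (simp add: sum_mult_delta)
  qed
  have ev: "ipr (e i) v = 0" if "i < k" for i
  proof -
    have "ipr (e i) (g j) = 0" if "j < m" for j
      using that \<open>i < k\<close> k fe orthonormalD(2)[OF f, of i "k + j"] by (auto simp: g_def m_def)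
    then show ?thesis unfolding v_def by (subst ipr_lincomb_right) (auto simp: g)
  qed
  have "v \<noteq> 0\<^sub>v n"
  proof
    assume "v = 0\<^sub>v n"
    then have "y $ i = 0" if "i < m" for i using gv[OF that] by (simp add: ipr_def)
    then show False using y by auto
  qed
  \<comment> \<open>Compare coefficients in the basis \<open>f\<close>. Against \<open>e i\<close>
    both sides vanish, since the hermitian \<open>A\<close> moves onto its eigenvector
    \<open>e i\<close>; against \<open>g j\<close> the claim is the eigenvalue equation of
    \<open>B\<close>.\<close>
  have Av: "A *\<^sub>v v = \<mu> \<cdot>\<^sub>v v"
  proof (rule orthonormal_eqI[OF f])
    fix i assume i: "i < n"
    show "ipr (f i) (A *\<^sub>v v) = ipr (f i) (\<mu> \<cdot>\<^sub>v v)"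
    proof (cases "i < k")
      case True
      have ec: "e i \<in> carrier_vec n" using orthonormalD(1)[OF e True] .
      have "ipr (e i) (A *\<^sub>v v) = ipr (l i \<cdot>\<^sub>v e i) v"
        using ipr_adj[OF A(1) ec v] A(2) eig True by simp
      then show ?thesis using True fe ev ec v
        by (simp add: ipr_smult_left[of _ n] ipr_smult_right[of _ n])
    next
      case False
      define j where "j = i - k"
      have j: "j < m" "f i = g j" using False i by (auto simp: j_def m_def g_def)
      have "ipr (g j) (A *\<^sub>v v) = (\<Sum>i<m. y $ i * ipr (g j) (A *\<^sub>v g i))"
        unfolding v_def by (subst mult_mat_lincomb[OF A(1)]) (auto simp: g ipr_lincomb_right[OF Ag])
      also have "\<dots> = (B *\<^sub>v y) $ j"
        using j by (subst mult_mat_vec_index[OF B y(1)]) (auto simp: B_def mult_ac)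
      also have "\<dots> = \<mu> * y $ j" using y j by simp
      finally show ?thesis using j gv g v by (simp add: ipr_smult_right[of _ n])
    qed
  qed (use A v in auto)
  obtain c where c: "unit_vec_in n (c \<cdot>\<^sub>v v)" using exists_normalization[OF v \<open>v \<noteq> _\<close>] by auto
  show ?thesis
  proof (intro exI conjI)
    show "\<forall>i<k. ipr (e i) (c \<cdot>\<^sub>v v) = 0"
      using ev v orthonormalD(1)[OF e] by (auto simp: ipr_smult_right[of _ n])
    show "A *\<^sub>v (c \<cdot>\<^sub>v v) = \<mu> \<cdot>\<^sub>v (c \<cdot>\<^sub>v v)"
      using A v Av by (simp add: mult_mat_vec smult_smult_assoc mult.commute)
  qed (rule c)
qed

lemma hermitian_eigenbasis:
  assumes "A \<in> carrier_mat n n" "adj A = A" "k \<le> n"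
  shows "\<exists>e l. orthonormal n k e \<and> (\<forall>i<k. A *\<^sub>v e i = l i \<cdot>\<^sub>v e i)"
  using assms(3)
proof (induction k)
  case (Suc k)
  then obtain e l where e: "orthonormal n k e" "\<forall>i<k. A *\<^sub>v e i = l i \<cdot>\<^sub>v e i" by auto
  obtain v \<mu> where v: "unit_vec_in n v" "\<forall>i<k. ipr (e i) v = 0" "A *\<^sub>v v = \<mu> \<cdot>\<^sub>v v"
    using hermitian_next_eigenvector[OF assms(1,2) e(1) _ e(2)] Suc.prems by auto
  show ?case
  proof (intro exI conjI)
    show "orthonormal n (Suc k) (e(k := v))" by (rule orthonormal_snoc[OF e(1) v(1,2)])
    show "\<forall>i<Suc k. A *\<^sub>v (e(k := v)) i = (l(k := \<mu>)) i \<cdot>\<^sub>v (e(k := v)) i"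
      using e(2) v(3) by (auto simp: less_Suc_eq)
  qed
qed (auto simp: orthonormal_def)

text \<open>\<open>eigdec\<close> asks for real eigenvalues; hermiticity allows the complex ones to
  be replaced by their real parts. Inserting the completeness relation of the eigenbasis behind
  \<open>A\<close> gives the spectral sum.\<close>

lemma hermitian_eigdec:
  assumes A: "A \<in> carrier_mat n n" "adj A = A"
  shows "\<exists>lam e. eigdec n A lam e"
proof -
  obtain e l where e: "orthonormal n n e" and l: "\<forall>i<n. A *\<^sub>v e i = l i \<cdot>\<^sub>v e i"
    using hermitian_eigenbasis[OF A order_refl] by auto
  have ec: "e i \<in> carrier_vec n" "ipr (e i) (e i) = 1" if "i < n" for i
    using orthonormalD[OF e that] that by auto
  have real: "complex_of_real (Re (l i)) = l i" if "i < n" for i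
  proof -
    have "ipr (e i) (A *\<^sub>v e i) = ipr (A *\<^sub>v e i) (e i)" using ipr_adj[OF A(1) ec(1) ec(1)] A(2) that by simp
    then have "l i = cnj (l i)"
      using l that ec by (simp add: ipr_smult_left[of _ n] ipr_smult_right[of _ n])
    then show ?thesis by (metis Reals_cnj_iff of_real_Re)
  qed
  have "A = mat n n (\<lambda>(a,b). \<Sum>k<n. complex_of_real (Re (l k)) * (e k $ a) * cnj (e k $ b))" (is "A = ?M")
  proof
    fix a b assume "a < dim_row ?M" "b < dim_col ?M"
    then have ab: "a < n" "b < n" by auto
    have "?M $$ (a,b) = (\<Sum>k<n. (A *\<^sub>v e k) $ a * cnj (e k $ b))"
    proof -
      have "(A *\<^sub>v e k) $ a = l k * e k $ a" if "k < n" for k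
        using l ec(1)[OF that] ab that by simp
      then show ?thesis using ab real by (simp del: index_mult_mat_vec)
    qed
    also have "\<dots> = (\<Sum>k<n. \<Sum>c<n. A $$ (a,c) * (e k $ c * cnj (e k $ b)))"
      using ab ec(1) by (simp add: mult_mat_vec_index[OF A(1)] sum_distrib_left mult_ac del: index_mult_mat_vec)
    also have "\<dots> = (\<Sum>c<n. \<Sum>k<n. A $$ (a,c) * (e k $ c * cnj (e k $ b)))" by (rule sum.swap)
    also have "\<dots> = (\<Sum>c<n. A $$ (a,c) * (if b = c then 1 else 0))"
    proof (intro sum.cong refl)
      fix c assume "c \<in> {..<n}"
      then have "(\<Sum>k<n. e k $ c * cnj (e k $ b)) = (if b = c then 1 else 0)"
        using ab orthonormal_complete[OF e, of c b] by (cases "b = c") auto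
      then show "(\<Sum>k<n. A $$ (a,c) * (e k $ c * cnj (e k $ b))) = A $$ (a,c) * (if b = c then 1 else 0)"
        by (simp only: sum_distrib_left[symmetric])
    qed
    also have "\<dots> = A $$ (a,b)" by (rule sum_mult_delta[OF ab(2)])
    finally show "A $$ (a,b) = ?M $$ (a,b)" ..
  qed (use A in auto)
  then have "eigdec n A (\<lambda>i. Re (l i)) e" using e unfolding eigdec_def orthonormal_def by (intro conjI) blast+
  then show ?thesis by (intro exI)
qed

section \<open>Positive semidefinite matrices\<close>

lemma eigdecD:
  assumes "eigdec n A lam e"
  shows "orthonormal n n e" "A \<in> carrier_mat n n"
    "a < n \<Longrightarrow> b < n \<Longrightarrow> A $$ (a,b) = (\<Sum>k<n. complex_of_real (lam k) * e k $ a * cnj (e k $ b))"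
  using assms by (auto simp: eigdec_def orthonormal_def)

lemma eigdec_carrier: "eigdec n A lam e \<Longrightarrow> k < n \<Longrightarrow> e k \<in> carrier_vec n"
  by (auto simp: eigdec_def)

lemma eigdec_mult_vec:
  assumes "eigdec n A lam e" "v \<in> carrier_vec n"
  shows "A *\<^sub>v v = lincomb n n (\<lambda>k. lam k * ipr (e k) v) e"
proof
  note A = eigdecD(2)[OF assms(1)]
  fix a assume "a < dim_vec (lincomb n n (\<lambda>k. lam k * ipr (e k) v) e)"
  then have a: "a < n" by (simp add: lincomb_def)
  have "(A *\<^sub>v v) $ a = (\<Sum>b<n. \<Sum>k<n. lam k * e k $ a * (cnj (e k $ b) * v $ b))"
    unfolding mult_mat_vec_index[OF A assms(2) a] using a
    by (intro sum.cong) (auto simp: eigdecD(3)[OF assms(1)] sum_distrib_left mult_ac)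
  also have "\<dots> = (\<Sum>k<n. \<Sum>b<n. lam k * e k $ a * (cnj (e k $ b) * v $ b))" by (rule sum.swap)
  also have "\<dots> = lincomb n n (\<lambda>k. lam k * ipr (e k) v) e $ a"
    using a assms(2) by (simp add: lincomb_def ipr_eq[of v n] sum_distrib_left mult_ac)
  finally show "(A *\<^sub>v v) $ a = lincomb n n (\<lambda>k. lam k * ipr (e k) v) e $ a" .
qed (use eigdecD(2)[OF assms(1)] in \<open>auto simp: lincomb_def\<close>)

lemma eigdec_form:
  assumes "eigdec n A lam e" "v \<in> carrier_vec n"
  shows "ipr v (A *\<^sub>v v) = complex_of_real (\<Sum>k<n. lam k * (cmod (ipr (e k) v))\<^sup>2)"
proof -
  have "ipr v (A *\<^sub>v v) = (\<Sum>k<n. lam k * ipr (e k) v * cnj (ipr (e k) v))"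
    unfolding eigdec_mult_vec[OF assms] using eigdec_carrier[OF assms(1)] assms(2)
    by (subst ipr_lincomb_right) (auto simp: ipr_cnj[of _ n])
  then show ?thesis by (simp add: complex_norm_square mult_ac del: of_real_power)
qed

lemma eigdec_eigenvector:
  assumes "eigdec n A lam e" "k < n"
  shows "A *\<^sub>v e k = complex_of_real (lam k) \<cdot>\<^sub>v e k"
proof -
  note c = eigdec_carrier[OF assms(1)]
  have "A *\<^sub>v e k = lincomb n n (\<lambda>j. lam k * ipr (e j) (e k)) e"
    unfolding eigdec_mult_vec[OF assms(1) c[OF assms(2)]]
    by (rule lincomb_cong) (use assms(2) orthonormalD(2)[OF eigdecD(1)[OF assms(1)]] in auto)
  also have "\<dots> = lam k \<cdot>\<^sub>v lincomb n n (\<lambda>j. ipr (e j) (e k)) e"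
    by (auto simp: lincomb_def sum_distrib_left mult_ac)
  also have "lincomb n n (\<lambda>j. ipr (e j) (e k)) e = e k"
    by (rule orthonormal_expand[OF eigdecD(1)[OF assms(1)] c[OF assms(2)], symmetric])
  finally show ?thesis .
qed

lemma eigdec_eigenvalue:
  assumes "eigdec n A lam e" "k < n"
  shows "ipr (e k) (A *\<^sub>v e k) = complex_of_real (lam k)"
  using eigdec_eigenvector[OF assms] eigdec_carrier[OF assms]
    orthonormalD(2)[OF eigdecD(1)[OF assms(1)] assms(2,2)] by (simp add: ipr_smult_right[of _ n])

text \<open>With \<open>M\<close> the identity this is the trace of \<open>A\<close>; with
  \<open>M\<close> an effect and \<open>A\<close> a state it is an outcome probability, spread over
  the eigenvectors of the state.\<close>

lemma mtrace_mult_eigdec: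
  assumes "eigdec n A lam e" "M \<in> carrier_mat n n"
  shows "mtrace (M * A) = (\<Sum>k<n. lam k * ipr (e k) (M *\<^sub>v e k))"
proof -
  note c = eigdec_carrier[OF assms(1)] and A = eigdecD(2)[OF assms(1)]
  have "mtrace (M * A) = (\<Sum>a<n. \<Sum>b<n. M $$ (a,b) * A $$ (b,a))"
    using assms(2) A by (auto simp: mtrace_def mult_mat_index[OF assms(2) A] simp del: index_mult_mat(1))
  also have "\<dots> = (\<Sum>a<n. \<Sum>b<n. \<Sum>k<n. lam k * (cnj (e k $ a) * (M $$ (a,b) * e k $ b)))"
    by (intro sum.cong refl) (simp add: eigdecD(3)[OF assms(1)] sum_distrib_left mult_ac)
  also have "\<dots> = (\<Sum>a<n. \<Sum>k<n. \<Sum>b<n. lam k * (cnj (e k $ a) * (M $$ (a,b) * e k $ b)))"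
    by (intro sum.cong refl sum.swap)
  also have "\<dots> = (\<Sum>k<n. \<Sum>a<n. \<Sum>b<n. lam k * (cnj (e k $ a) * (M $$ (a,b) * e k $ b)))"
    by (rule sum.swap)
  also have "\<dots> = (\<Sum>k<n. lam k * (\<Sum>a<n. cnj (e k $ a) * (M *\<^sub>v e k) $ a))"
    using c by (intro sum.cong refl)
      (simp add: mult_mat_vec_index[OF assms(2)] sum_distrib_left del: index_mult_mat_vec)
  also have "\<dots> = (\<Sum>k<n. lam k * ipr (e k) (M *\<^sub>v e k))"
    using assms(2) c by (intro sum.cong refl) (subst ipr_eq[of _ n], auto)
  finally show ?thesis .
qed

lemma eigdec_trace:
  assumes "eigdec n A lam e"
  shows "mtrace A = complex_of_real (\<Sum>k<n. lam k)"
proof -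
  have "mtrace A = mtrace (1\<^sub>m n * A)" using eigdecD(2)[OF assms] by simp
  also have "\<dots> = (\<Sum>k<n. lam k * ipr (e k) (1\<^sub>m n *\<^sub>v e k))"
    by (rule mtrace_mult_eigdec[OF assms one_carrier_mat])
  also have "\<dots> = complex_of_real (\<Sum>k<n. lam k)"
    using eigdec_carrier[OF assms] orthonormalD(2)[OF eigdecD(1)[OF assms]] by simp
  finally show ?thesis .
qed

lemma psdD:
  assumes "psd n A"
  shows "A \<in> carrier_mat n n" "adj A = A" "v \<in> carrier_vec n \<Longrightarrow> Re (ipr v (A *\<^sub>v v)) \<ge> 0"
  using assms by (auto simp: psd_def)

lemma psd_eigdec: "psd n A \<Longrightarrow> \<exists>lam e. eigdec n A lam e"
  by (rule hermitian_eigdec) (auto dest: psdD)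

lemma psd_eigdec_nonneg:
  assumes "psd n A" "eigdec n A lam e" "k < n"
  shows "lam k \<ge> 0"
  using psdD(3)[OF assms(1) eigdec_carrier[OF assms(2,3)]] eigdec_eigenvalue[OF assms(2,3)] by simp

lemma psd_trace:
  assumes "psd n A"
  shows "mtrace A = complex_of_real (Re (mtrace A))" "Re (mtrace A) \<ge> 0"
proof -
  obtain lam e where e: "eigdec n A lam e" using psd_eigdec[OF assms] by auto
  show "mtrace A = complex_of_real (Re (mtrace A))" "Re (mtrace A) \<ge> 0"
    unfolding eigdec_trace[OF e] using psd_eigdec_nonneg[OF assms e] by (auto intro!: sum_nonneg)
qed

lemma psd_trace_eq_0:
  assumes "psd n A" "mtrace A = 0"
  shows "A = 0\<^sub>m n n"
proof -
  obtain lam e where e: "eigdec n A lam e" using psd_eigdec[OF assms(1)] by auto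
  have "(\<Sum>k<n. lam k) = 0" using assms(2) unfolding eigdec_trace[OF e] of_real_eq_0_iff .
  then have "\<forall>k<n. lam k = 0" by (subst (asm) sum_nonneg_eq_0_iff) (auto intro!: psd_eigdec_nonneg[OF assms(1) e] mult_nonneg_nonneg)
  then show ?thesis using eigdecD[OF e] by (intro eq_matI) auto
qed

text \<open>The form is a sum of the nonnegative terms
  \<open>lam k * (cmod (ipr (e k) v))\<^sup>2\<close>. If it vanishes, so does each term, and with
  it each coefficient of \<open>A *\<^sub>v v\<close>.\<close>

lemma psd_form_eq_0:
  assumes "psd n A" "v \<in> carrier_vec n" "ipr v (A *\<^sub>v v) = 0"
  shows "A *\<^sub>v v = 0\<^sub>v n"
proof -
  obtain lam e where e: "eigdec n A lam e" using psd_eigdec[OF assms(1)] by auto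
  have "(\<Sum>k<n. lam k * (cmod (ipr (e k) v))\<^sup>2) = 0"
    using assms(3) unfolding eigdec_form[OF e assms(2)] of_real_eq_0_iff .
  then have "\<forall>k<n. lam k * (cmod (ipr (e k) v))\<^sup>2 = 0"
    by (subst (asm) sum_nonneg_eq_0_iff) (auto intro!: psd_eigdec_nonneg[OF assms(1) e] mult_nonneg_nonneg)
  then have "\<forall>k<n. complex_of_real (lam k) * ipr (e k) v = 0" by auto
  then show ?thesis unfolding eigdec_mult_vec[OF e assms(2)]
    by (intro eq_vecI) (auto simp: lincomb_def intro!: sum.neutral)
qed

lemma adj_mult:
  assumes "A \<in> carrier_mat m n" "B \<in> carrier_mat n p"
  shows "adj (A * B) = adj B * adj A"
proof
  fix i j assume "i < dim_row (adj B * adj A)" "j < dim_col (adj B * adj A)"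
  then have ij: "i < p" "j < m" using assms by (auto simp: adj_def)
  have "adj (A * B) $$ (i,j) = cnj ((A * B) $$ (j,i))" using ij assms by (simp add: adj_def)
  also have "\<dots> = (\<Sum>k<n. cnj (B $$ (k,i)) * cnj (A $$ (j,k)))"
    unfolding mult_mat_index[OF assms ij(2,1)] by (simp add: mult.commute)
  also have "\<dots> = (adj B * adj A) $$ (i,j)"
    unfolding mult_mat_index[OF adj_carrier[OF assms(2)] adj_carrier[OF assms(1)] ij]
    using ij assms by (simp add: adj_def)
  finally show "adj (A * B) $$ (i,j) = (adj B * adj A) $$ (i,j)" .
qed (use assms in \<open>auto simp: adj_def\<close>)

lemma adj_adj [simp]: "adj (adj A) = A"
  by (auto simp: adj_def)

lemma adj_one [simp]: "adj (1\<^sub>m n) = 1\<^sub>m n"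
  by (auto simp: adj_def)

text \<open>Moving \<open>adj K\<close> to the other side of the inner product turns the form at
  \<open>v\<close> into the form of \<open>F\<close> at \<open>K *\<^sub>v v\<close>.\<close>

lemma psd_conj:
  assumes "psd n F" "K \<in> carrier_mat n n"
  shows "psd n (adj K * F * K)"
proof -
  note F = psdD[OF assms(1)]
  have aK: "adj K \<in> carrier_mat n n" using assms(2) by simp
  have "adj (adj K * F * K) = adj K * (F * K)"
    using adj_mult[OF mult_carrier_mat[OF aK F(1)] assms(2)] adj_mult[OF aK F(1)] F(2) by simp
  then have "adj (adj K * F * K) = adj K * F * K"
    using assoc_mult_mat[OF aK F(1) assms(2)] by simp
  moreover have "Re (ipr v ((adj K * F * K) *\<^sub>v v)) \<ge> 0" if v: "v \<in> carrier_vec n" for v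
  proof -
    have Kv: "K *\<^sub>v v \<in> carrier_vec n" using v assms(2) by auto
    have "(adj K * F * K) *\<^sub>v v = adj K *\<^sub>v (F *\<^sub>v (K *\<^sub>v v))"
      using assoc_mult_mat_vec[OF mult_carrier_mat[OF aK F(1)] assms(2) v] assoc_mult_mat_vec[OF aK F(1) Kv]
      by simp
    then have "ipr v ((adj K * F * K) *\<^sub>v v) = ipr (K *\<^sub>v v) (F *\<^sub>v (K *\<^sub>v v))"
      using ipr_adj[OF aK v, of "F *\<^sub>v (K *\<^sub>v v)"] F(1) Kv by simp
    then show ?thesis using F(3)[OF Kv] by simp
  qed
  ultimately show ?thesis
    using mult_carrier_mat[OF mult_carrier_mat[OF aK F(1)] assms(2)] unfolding psd_def by blast
qed

lemma psd_one: "psd n (1\<^sub>m n)"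
  by (auto simp: psd_def ipr_self sum_nonneg simp del: of_real_sum)

lemma ipr_msum:
  assumes "finite S" "\<forall>j\<in>S. f j \<in> carrier_mat n n" "v \<in> carrier_vec n" "w \<in> carrier_vec n"
  shows "ipr w (msum n S f *\<^sub>v v) = (\<Sum>j\<in>S. ipr w (f j *\<^sub>v v))"
proof -
  have c: "msum n S f \<in> carrier_mat n n" by (simp add: msum_def)
  have "ipr w (msum n S f *\<^sub>v v) = (\<Sum>a<n. \<Sum>b<n. \<Sum>j\<in>S. cnj (w $ a) * (f j $$ (a,b) * v $ b))"
  proof -
    have "(msum n S f *\<^sub>v v) $ a = (\<Sum>b<n. \<Sum>j\<in>S. f j $$ (a,b) * v $ b)" if "a < n" for a
      unfolding mult_mat_vec_index[OF c assms(3) that] using that by (simp add: msum_def sum_distrib_right)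
    then show ?thesis using mult_mat_vec_carrier[OF c assms(3)]
      by (simp add: ipr_eq[of _ n] sum_distrib_left del: index_mult_mat_vec)
  qed
  also have "\<dots> = (\<Sum>a<n. \<Sum>j\<in>S. \<Sum>b<n. cnj (w $ a) * (f j $$ (a,b) * v $ b))"
    by (intro sum.cong refl sum.swap)
  also have "\<dots> = (\<Sum>j\<in>S. \<Sum>a<n. \<Sum>b<n. cnj (w $ a) * (f j $$ (a,b) * v $ b))" by (rule sum.swap)
  also have "\<dots> = (\<Sum>j\<in>S. ipr w (f j *\<^sub>v v))"
  proof (rule sum.cong[OF refl])
    fix j assume "j \<in> S"
    then have f: "f j \<in> carrier_mat n n" using assms by auto
    show "(\<Sum>a<n. \<Sum>b<n. cnj (w $ a) * (f j $$ (a,b) * v $ b)) = ipr w (f j *\<^sub>v v)"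
      using f assms by (subst ipr_eq[of _ n])
        (auto simp: mult_mat_vec_index[OF f] sum_distrib_left simp del: index_mult_mat_vec)
  qed
  finally show ?thesis .
qed

lemma psd_msum:
  assumes "finite S" "\<forall>j\<in>S. psd n (f j)"
  shows "psd n (msum n S f)"
proof -
  have "adj (msum n S f) = msum n S f"
  proof
    fix a b assume "a < dim_row (msum n S f)" "b < dim_col (msum n S f)"
    then have ab: "a < n" "b < n" by (auto simp: msum_def)
    have "cnj (f j $$ (b,a)) = f j $$ (a,b)" if "j \<in> S" for j
    proof -
      have "f j $$ (a,b) = adj (f j) $$ (a,b)" using psdD(2)[of n "f j"] assms that by simp
      also have "\<dots> = cnj (f j $$ (b,a))" using psdD(1)[of n "f j"] assms that ab by (simp add: adj_def)
      finally show ?thesis by simp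
    qed
    then show "adj (msum n S f) $$ (a,b) = msum n S f $$ (a,b)" using ab by (simp add: adj_def msum_def)
  qed (auto simp: adj_def msum_def)
  moreover have "Re (ipr v (msum n S f *\<^sub>v v)) \<ge> 0" if "v \<in> carrier_vec n" for v
    using assms that psdD(1,3) by (subst ipr_msum) (auto intro!: sum_nonneg)
  ultimately show ?thesis by (auto simp: psd_def msum_def)
qed

section \<open>Rank-one operators and effects that occur with certainty\<close>

lemma outer_carrier [simp]: "v \<in> carrier_vec n \<Longrightarrow> outer v \<in> carrier_mat n n"
  by (auto simp: outer_def)

lemma outer_mult_vec:
  assumes "\<psi> \<in> carrier_vec n" "v \<in> carrier_vec n"
  shows "outer \<psi> *\<^sub>v v = ipr \<psi> v \<cdot>\<^sub>v \<psi>"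
proof
  fix a assume "a < dim_vec (ipr \<psi> v \<cdot>\<^sub>v \<psi>)"
  then have a: "a < n" using assms by simp
  have "(outer \<psi> *\<^sub>v v) $ a = (\<Sum>b<n. \<psi> $ a * cnj (\<psi> $ b) * v $ b)"
    unfolding mult_mat_vec_index[OF outer_carrier[OF assms(1)] assms(2) a]
    using assms a by (auto simp: outer_def)
  then show "(outer \<psi> *\<^sub>v v) $ a = (ipr \<psi> v \<cdot>\<^sub>v \<psi>) $ a"
    using a assms by (simp add: ipr_eq[of v n] sum_distrib_left mult_ac)
qed (use assms in \<open>auto simp: outer_def\<close>)

lemma outer_form:
  assumes "\<psi> \<in> carrier_vec n" "v \<in> carrier_vec n"
  shows "ipr v (outer \<psi> *\<^sub>v v) = complex_of_real ((cmod (ipr \<psi> v))\<^sup>2)"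
  using assms by (simp add: outer_mult_vec ipr_smult_right[of _ n] ipr_cnj[symmetric, of \<psi> n v]
      complex_norm_square del: of_real_power)

lemma adj_outer [simp]: "adj (outer v) = outer v"
  by (auto simp: adj_def outer_def)

lemma mtrace_outer: "v \<in> carrier_vec n \<Longrightarrow> mtrace (outer v) = ipr v v"
  by (auto simp: mtrace_def outer_def ipr_def mult.commute)

lemma ipr_diff:
  assumes "u \<in> carrier_vec n" "v \<in> carrier_vec n" "w \<in> carrier_vec n"
  shows "ipr u (v - w) = ipr u v - ipr u w" "ipr (v - w) u = ipr v u - ipr w u"
  using assms by (auto simp: ipr_def algebra_simps sum_subtractf)

lemma ipr_add:
  assumes "u \<in> carrier_vec n" "v \<in> carrier_vec n" "w \<in> carrier_vec n"
  shows "ipr u (v + w) = ipr u v + ipr u w"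
  using assms by (auto simp: ipr_def algebra_simps sum.distrib)

text \<open>Splitting \<open>v\<close> along \<open>\<psi>\<close> and its complement, the cross terms of the form of \<open>A\<close> vanish.\<close>

lemma psd_minus_outer:
  assumes A: "psd n A" and \<psi>: "unit_vec_in n \<psi>" and eig: "A *\<^sub>v \<psi> = \<psi>"
  shows "psd n (A - outer \<psi>)"
proof -
  note Ac = psdD(1)[OF A]
  have pc: "\<psi> \<in> carrier_vec n" and pp: "ipr \<psi> \<psi> = 1" using \<psi> by (auto simp: unit_vec_in_def)
  have "adj (A - outer \<psi>) = adj A - adj (outer \<psi>)"
    using Ac outer_carrier[OF pc] by (auto simp: adj_def)
  then have "adj (A - outer \<psi>) = A - outer \<psi>" using psdD(2)[OF A] by simp
  moreover have "Re (ipr v ((A - outer \<psi>) *\<^sub>v v)) \<ge> 0" if v: "v \<in> carrier_vec n" for v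
  proof -
    define c where "c = ipr \<psi> v"
    define u where "u = v - c \<cdot>\<^sub>v \<psi>"
    have u: "u \<in> carrier_vec n" using v pc by (auto simp: u_def)
    have pu: "ipr \<psi> u = 0"
      using v pc pp by (simp add: u_def ipr_diff[of _ n] ipr_smult_right[of _ n] c_def)
    have "A *\<^sub>v u = A *\<^sub>v v - c \<cdot>\<^sub>v \<psi>"
      using v pc Ac eig by (simp add: u_def mult_minus_distrib_mat_vec[of _ n n] mult_mat_vec[of _ n n])
    \<comment> \<open>As \<open>A\<close> fixes \<open>\<psi>\<close>, subtracting the projector
      removes exactly the contribution of the component along \<open>\<psi>\<close>.\<close>
    then have Au: "(A - outer \<psi>) *\<^sub>v v = A *\<^sub>v u"
      using v pc Ac by (simp add: minus_mult_distrib_mat_vec[of _ n n] outer_mult_vec c_def)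
    have "ipr \<psi> (A *\<^sub>v u) = ipr \<psi> u"
      using ipr_adj[OF Ac pc u] psdD(2)[OF A] eig by simp
    then have z: "ipr \<psi> (A *\<^sub>v u) = 0" using pu by simp
    have "v = u + c \<cdot>\<^sub>v \<psi>" using v pc by (auto simp: u_def)
    then have "ipr (A *\<^sub>v u) v = ipr (A *\<^sub>v u) u + c * ipr (A *\<^sub>v u) \<psi>"
      using u pc Ac by (simp add: ipr_add[of _ n] ipr_smult_right[of _ n])
    also have "ipr (A *\<^sub>v u) \<psi> = 0" using ipr_cnj[of \<psi> n "A *\<^sub>v u"] z pc u Ac by simp
    finally have "ipr v (A *\<^sub>v u) = ipr u (A *\<^sub>v u)"
      using ipr_cnj[of v n "A *\<^sub>v u"] ipr_cnj[of u n "A *\<^sub>v u"] u v Ac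
      by (metis add.right_neutral complex_cnj_cancel_iff mult_mat_vec_carrier mult_zero_right)
    then show ?thesis using Au psdD(3)[OF A u] by simp
  qed
  ultimately show ?thesis using minus_carrier_mat[OF outer_carrier[OF pc]] by (simp add: psd_def)
qed

text \<open>For \<open>M = 1 - P\<close> the trace of \<open>M * \<sigma>\<close> is zero. In an
  eigenbasis of \<open>\<sigma>\<close> it is a sum of nonnegative terms, so \<open>M\<close> kills
  every eigenvector of nonzero weight.\<close>

lemma effect_fixes_support:
  assumes P: "P \<in> carrier_mat n n" "psd n (1\<^sub>m n - P)" and \<sigma>: "density n \<sigma>"
    and tr: "mtrace (P * \<sigma>) = 1" and \<psi>: "\<psi> \<in> supp_mat n \<sigma>"
  shows "P *\<^sub>v \<psi> = \<psi>"
proof -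
  define M where "M = 1\<^sub>m n - P"
  have M: "psd n M" "M \<in> carrier_mat n n" using P by (auto simp: M_def)
  have \<sigma>': "psd n \<sigma>" "mtrace \<sigma> = 1" using \<sigma> by (auto simp: density_def)
  obtain lam e where e: "eigdec n \<sigma> lam e" using psd_eigdec[OF \<sigma>'(1)] by auto
  note ec = eigdec_carrier[OF e] and nn = psd_eigdec_nonneg[OF \<sigma>'(1) e]
  have Mv: "M *\<^sub>v v = v - P *\<^sub>v v" if "v \<in> carrier_vec n" for v
    using that P by (simp add: M_def minus_mult_distrib_mat_vec[of _ n n])
  have "(\<Sum>k<n. lam k * ipr (e k) (M *\<^sub>v e k)) = (\<Sum>k<n. complex_of_real (lam k)) - mtrace (P * \<sigma>)"
    using ec P orthonormalD(2)[OF eigdecD(1)[OF e]]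
    by (simp add: Mv mtrace_mult_eigdec[OF e P(1)] ipr_diff[of _ n] algebra_simps sum_subtractf)
  also have "\<dots> = 0" using tr \<sigma>'(2) eigdec_trace[OF e] by simp
  finally have s: "(\<Sum>k<n. lam k * ipr (e k) (M *\<^sub>v e k)) = 0" .
  \<comment> \<open>\<open>psd\<close> speaks of the real part only; the form of a hermitian matrix
    is real, so a vanishing real part means a vanishing form.\<close>
  have real: "ipr v (M *\<^sub>v v) = complex_of_real (Re (ipr v (M *\<^sub>v v)))" if "v \<in> carrier_vec n" for v
  proof -
    obtain lam' e' where "eigdec n M lam' e'" using psd_eigdec[OF M(1)] by auto
    from eigdec_form[OF this that] show ?thesis by simp
  qed
  have "complex_of_real (\<Sum>k<n. lam k * Re (ipr (e k) (M *\<^sub>v e k))) = 0"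
    using s real[OF ec] by simp
  then have "(\<Sum>k<n. lam k * Re (ipr (e k) (M *\<^sub>v e k))) = 0" unfolding of_real_eq_0_iff .
  then have "\<forall>k<n. lam k * Re (ipr (e k) (M *\<^sub>v e k)) = 0"
    by (subst (asm) sum_nonneg_eq_0_iff) (auto intro!: mult_nonneg_nonneg nn psdD(3)[OF M(1)] ec)
  then have Me: "lam k = 0 \<or> M *\<^sub>v e k = 0\<^sub>v n" if "k < n" for k
    using that psd_form_eq_0[OF M(1) ec[OF that]] real[OF ec[OF that]] by auto
  \<comment> \<open>\<open>supp_mat\<close> is spanned by all eigenvectors of nonzero eigenvalue,
    not only by the chosen \<open>e k\<close>. Such a vector lies in the range of
    \<open>\<sigma>\<close>, and killing the range avoids comparing two eigenbases.\<close>
  have M\<sigma>: "M *\<^sub>v (\<sigma> *\<^sub>v v) = 0\<^sub>v n" if "v \<in> carrier_vec n" for v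
  proof -
    have "M *\<^sub>v (\<sigma> *\<^sub>v v) = lincomb n n (\<lambda>k. lam k * ipr (e k) v) (\<lambda>k. M *\<^sub>v e k)"
      unfolding eigdec_mult_vec[OF e that] by (rule mult_mat_lincomb[OF M(2) ec])
    also have "\<dots> = 0\<^sub>v n"
    proof -
      have "(complex_of_real (lam k) * ipr (e k) v) * (M *\<^sub>v e k) $ a = 0" if "k < n" "a < n" for k a
        using Me[OF that(1)] that by auto
      then show ?thesis by (auto simp: lincomb_def simp del: index_mult_mat_vec mult_eq_0_iff)
    qed
    finally show ?thesis .
  qed
  obtain k :: nat and c w where w: "\<forall>i<k. w i \<in> carrier_vec n \<and> (\<exists>l. l \<noteq> 0 \<and> \<sigma> *\<^sub>v w i = l \<cdot>\<^sub>v w i)"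
    and pw: "\<psi> = lincomb n k c w"
    using \<psi> unfolding supp_mat_def lin_span_def lincomb_def by blast
  have Mw: "M *\<^sub>v w i = 0\<^sub>v n" if i: "i < k" for i
  proof -
    obtain l where l: "l \<noteq> 0" "\<sigma> *\<^sub>v w i = l \<cdot>\<^sub>v w i" and wi: "w i \<in> carrier_vec n" using w i by auto
    have "l \<cdot>\<^sub>v (M *\<^sub>v w i) = 0\<^sub>v n"
      using M\<sigma>[OF wi] l wi M(2) by (simp add: mult_mat_vec[of _ n n])
    then have "(1/l) \<cdot>\<^sub>v (l \<cdot>\<^sub>v (M *\<^sub>v w i)) = 0\<^sub>v n" by auto
    then show ?thesis using l by (simp add: smult_smult_assoc)
  qed
  have "M *\<^sub>v \<psi> = lincomb n k c (\<lambda>i. M *\<^sub>v w i)"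
    unfolding pw by (rule mult_mat_lincomb[OF M(2)]) (use w in auto)
  also have "\<dots> = lincomb n k c (\<lambda>i. 0\<^sub>v n)" by (rule lincomb_cong) (auto simp: Mw)
  also have "\<dots> = 0\<^sub>v n" by (auto simp: lincomb_def)
  finally have z: "\<psi> - P *\<^sub>v \<psi> = 0\<^sub>v n" using Mv[of \<psi>] pw by simp
  have pc: "\<psi> \<in> carrier_vec n" using pw by simp
  show ?thesis
  proof
    fix a assume a: "a < dim_vec \<psi>"
    then have "(\<psi> - P *\<^sub>v \<psi>) $ a = 0" using z pc by simp
    then show "(P *\<^sub>v \<psi>) $ a = \<psi> $ a" using a pc P by (simp del: index_mult_mat_vec)
  qed (use pc P in auto)
qed

section \<open>Product operators\<close>

lemma nth_pos: "\<forall>d\<in>set ds. d > 0 \<Longrightarrow> l < length ds \<Longrightarrow> ds ! l > (0::nat)"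
  by simp

lemma digit_less: "\<forall>d\<in>set ds. d > 0 \<Longrightarrow> l < length ds \<Longrightarrow> digit ds l a < ds ! l"
  by (simp add: digit_def)

text \<open>The head of the list is the most significant digit and the tail keeps its digits.
  Residues are compared because in the induction \<open>a\<close> may exceed the range of the
  tail.\<close>

lemma digits_determine_mod:
  "(\<And>l. l < length ds \<Longrightarrow> digit ds l a = digit ds l b) \<Longrightarrow> a mod prod_list ds = b mod prod_list ds"
proof (induction ds)
  case (Cons d ds)
  have "digit ds l a = digit ds l b" if "l < length ds" for l
    using Cons.prems[of "Suc l"] that by (simp add: digit_def)
  then have "a mod prod_list ds = b mod prod_list ds" by (rule Cons.IH)
  moreover have "a div prod_list ds mod d = b div prod_list ds mod d"
    using Cons.prems[of 0] by (simp add: digit_def)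
  ultimately show ?case by (simp add: mult.commute[of d] mod_mult2_eq)
qed simp

lemma digits_inj:
  assumes "a < dimH ds" "b < dimH ds" "\<And>l. l < length ds \<Longrightarrow> digit ds l a = digit ds l b"
  shows "a = b"
  using digits_determine_mod[of ds a b] assms by (simp add: dimH_def)

lemma dimH_eq_prod: "dimH ds = (\<Prod>l<length ds. ds ! l)"
  unfolding dimH_def by (induction ds) (simp_all add: prod.lessThan_Suc_shift del: prod.lessThan_Suc)

text \<open>Injectivity and equal finite cardinalities give surjectivity, so no inverse has to be
  written down. The restriction makes the digit tuples extensional.\<close>

lemma digits_bij:
  assumes "\<forall>d\<in>set ds. d > 0"
  shows "bij_betw (\<lambda>a. \<lambda>l\<in>{..<length ds}. digit ds l a) {..<dimH ds} (\<Pi>\<^sub>E l\<in>{..<length ds}. {..<ds ! l})"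
proof (rule bij_betw_imageI)
  let ?f = "\<lambda>a. \<lambda>l\<in>{..<length ds}. digit ds l a"
  show inj: "inj_on ?f {..<dimH ds}"
  proof
    fix a b assume ab: "a \<in> {..<dimH ds}" "b \<in> {..<dimH ds}" and eq: "?f a = ?f b"
    have "digit ds l a = digit ds l b" if "l < length ds" for l
      using fun_cong[OF eq, of l] that by simp
    then show "a = b" using digits_inj ab by auto
  qed
  show "?f ` {..<dimH ds} = (\<Pi>\<^sub>E l\<in>{..<length ds}. {..<ds ! l})"
  proof (rule card_subset_eq)
    show "finite (\<Pi>\<^sub>E l\<in>{..<length ds}. {..<ds ! l})" by (intro finite_PiE) auto
    show "?f ` {..<dimH ds} \<subseteq> (\<Pi>\<^sub>E l\<in>{..<length ds}. {..<ds ! l})"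
      using digit_less[OF assms] by (intro image_subsetI) (simp add: restrict_PiE_iff)
    show "card (?f ` {..<dimH ds}) = card (\<Pi>\<^sub>E l\<in>{..<length ds}. {..<ds ! l})"
      using card_image[OF inj] by (simp add: card_PiE dimH_eq_prod)
  qed
qed

text \<open>The distributive law, read along the digit bijection. It is the source of the product
  rules for multiplication and trace and of the decomposition of product states below.\<close>

lemma sum_prod_digits:
  fixes f :: "nat \<Rightarrow> nat \<Rightarrow> 'a::comm_semiring_1"
  assumes "\<forall>d\<in>set ds. d > 0"
  shows "(\<Sum>a<dimH ds. \<Prod>l<length ds. f l (digit ds l a)) = (\<Prod>l<length ds. \<Sum>i<ds ! l. f l i)"
proof -
  have "(\<Prod>l<length ds. \<Sum>i<ds ! l. f l i)
      = (\<Sum>g\<in>(\<Pi>\<^sub>E l\<in>{..<length ds}. {..<ds ! l}). \<Prod>l<length ds. f l (g l))"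
    by (rule prod_sum_PiE) auto
  also have "\<dots> = (\<Sum>a<dimH ds. \<Prod>l<length ds. f l ((\<lambda>l\<in>{..<length ds}. digit ds l a) l))"
    by (rule sum.reindex_bij_betw[OF digits_bij[OF assms], symmetric])
  finally show ?thesis by simp
qed

section \<open>Calculus of product and local operators\<close>

lemma prod_mat_carrier [simp]: "prod_mat ds A \<in> carrier_mat (dimH ds) (dimH ds)"
  by (simp add: prod_mat_def)

lemma prod_mat_index:
  "a < dimH ds \<Longrightarrow> b < dimH ds \<Longrightarrow> prod_mat ds A $$ (a,b) = (\<Prod>l<length ds. A l $$ (digit ds l a, digit ds l b))"
  by (simp add: prod_mat_def)

lemma prod_mat_cong:
  "(\<And>l. l < length ds \<Longrightarrow> A l = B l) \<Longrightarrow> prod_mat ds A = prod_mat ds B"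
  by (auto simp: prod_mat_def intro!: cong_mat prod.cong)

lemma prod_mat_mult:
  assumes ds: "\<forall>d\<in>set ds. d > 0"
    and A: "\<And>l. l < length ds \<Longrightarrow> A l \<in> carrier_mat (ds ! l) (ds ! l)"
    and B: "\<And>l. l < length ds \<Longrightarrow> B l \<in> carrier_mat (ds ! l) (ds ! l)"
  shows "prod_mat ds A * prod_mat ds B = prod_mat ds (\<lambda>l. A l * B l)"
proof
  fix a b assume "a < dim_row (prod_mat ds (\<lambda>l. A l * B l))" "b < dim_col (prod_mat ds (\<lambda>l. A l * B l))"
  then have ab: "a < dimH ds" "b < dimH ds" by (auto simp: prod_mat_def)
  have "(prod_mat ds A * prod_mat ds B) $$ (a,b)
      = (\<Sum>c<dimH ds. \<Prod>l<length ds. A l $$ (digit ds l a, digit ds l c) * B l $$ (digit ds l c, digit ds l b))"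
    unfolding mult_mat_index[OF prod_mat_carrier prod_mat_carrier ab]
    using ab by (intro sum.cong) (auto simp: prod_mat_index prod.distrib)
  also have "\<dots> = (\<Prod>l<length ds. \<Sum>i<ds ! l. A l $$ (digit ds l a, i) * B l $$ (i, digit ds l b))"
    by (rule sum_prod_digits[OF ds])
  also have "\<dots> = (\<Prod>l<length ds. (A l * B l) $$ (digit ds l a, digit ds l b))"
    using digit_less[OF ds] by (intro prod.cong refl) (auto simp: mult_mat_index[OF A B] simp del: index_mult_mat(1))
  finally show "(prod_mat ds A * prod_mat ds B) $$ (a,b) = prod_mat ds (\<lambda>l. A l * B l) $$ (a,b)"
    using ab by (simp add: prod_mat_index)
qed (auto simp: prod_mat_def)

lemma adj_index: "A \<in> carrier_mat m n \<Longrightarrow> i < n \<Longrightarrow> j < m \<Longrightarrow> adj A $$ (i,j) = cnj (A $$ (j,i))"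
  by (auto simp: adj_def)

lemma mtrace_eq: "A \<in> carrier_mat n n \<Longrightarrow> mtrace A = (\<Sum>i<n. A $$ (i,i))"
  by (auto simp: mtrace_def)

lemma adj_prod_mat:
  assumes ds: "\<forall>d\<in>set ds. d > 0"
    and A: "\<And>l. l < length ds \<Longrightarrow> A l \<in> carrier_mat (ds ! l) (ds ! l)"
  shows "adj (prod_mat ds A) = prod_mat ds (\<lambda>l. adj (A l))"
proof
  fix a b assume "a < dim_row (prod_mat ds (\<lambda>l. adj (A l)))" "b < dim_col (prod_mat ds (\<lambda>l. adj (A l)))"
  then have ab: "a < dimH ds" "b < dimH ds" by (auto simp: prod_mat_def)
  have "adj (prod_mat ds A) $$ (a,b) = (\<Prod>l<length ds. cnj (A l $$ (digit ds l b, digit ds l a)))"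
    using ab by (simp add: adj_def prod_mat_def)
  also have "\<dots> = (\<Prod>l<length ds. adj (A l) $$ (digit ds l a, digit ds l b))"
    using digit_less[OF ds] by (intro prod.cong refl) (auto simp: adj_index[OF A])
  finally show "adj (prod_mat ds A) $$ (a,b) = prod_mat ds (\<lambda>l. adj (A l)) $$ (a,b)"
    using ab by (simp add: prod_mat_index)
qed (auto simp: prod_mat_def adj_def)

lemma mtrace_prod_mat:
  assumes ds: "\<forall>d\<in>set ds. d > 0"
    and A: "\<And>l. l < length ds \<Longrightarrow> A l \<in> carrier_mat (ds ! l) (ds ! l)"
  shows "mtrace (prod_mat ds A) = (\<Prod>l<length ds. mtrace (A l))"
proof -
  have "mtrace (prod_mat ds A) = (\<Sum>a<dimH ds. \<Prod>l<length ds. A l $$ (digit ds l a, digit ds l a))"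
    by (auto simp: mtrace_def prod_mat_def)
  also have "\<dots> = (\<Prod>l<length ds. \<Sum>i<ds ! l. A l $$ (i,i))" by (rule sum_prod_digits[OF ds])
  also have "\<dots> = (\<Prod>l<length ds. mtrace (A l))"
    by (intro prod.cong refl) (auto simp: mtrace_eq[OF A])
  finally show ?thesis .
qed

lemma prod_mat_one:
  assumes ds: "\<forall>d\<in>set ds. d > 0"
  shows "prod_mat ds (\<lambda>l. 1\<^sub>m (ds ! l)) = 1\<^sub>m (dimH ds)"
proof
  fix a b assume "a < dim_row (1\<^sub>m (dimH ds) :: complex mat)" "b < dim_col (1\<^sub>m (dimH ds) :: complex mat)"
  then have ab: "a < dimH ds" "b < dimH ds" by auto
  have "prod_mat ds (\<lambda>l. 1\<^sub>m (ds ! l)) $$ (a,b)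
      = (\<Prod>l<length ds. if digit ds l a = digit ds l b then 1 else 0)"
    using ab digit_less[OF ds] by (auto simp: prod_mat_index intro!: prod.cong)
  also have "\<dots> = 1\<^sub>m (dimH ds) $$ (a,b)"
  proof (cases "a = b")
    case False
    then obtain l where "l < length ds" "digit ds l a \<noteq> digit ds l b" using digits_inj[OF ab] by auto
    then show ?thesis using False ab by (auto intro!: prod_zero)
  qed (use ab in auto)
  finally show "prod_mat ds (\<lambda>l. 1\<^sub>m (ds ! l)) $$ (a,b) = 1\<^sub>m (dimH ds) $$ (a,b)" .
qed (auto simp: prod_mat_def)

lemma loc_carrier [simp]: "loc ds k A \<in> carrier_mat (dimH ds) (dimH ds)"
  by (simp add: loc_def)

text \<open>Brings local operators under the product calculus: away from party \<open>k\<close> the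
  identity factors test equality of digits, which is the case split in \<open>loc\<close>.\<close>

lemma loc_eq_prod_mat:
  assumes ds: "\<forall>d\<in>set ds. d > 0" and k: "k < length ds"
  shows "loc ds k A = prod_mat ds (\<lambda>l. if l = k then A else 1\<^sub>m (ds ! l))"
proof
  fix a b assume "a < dim_row (prod_mat ds (\<lambda>l. if l = k then A else 1\<^sub>m (ds ! l)))"
    "b < dim_col (prod_mat ds (\<lambda>l. if l = k then A else 1\<^sub>m (ds ! l)))"
  then have ab: "a < dimH ds" "b < dimH ds" by (auto simp: prod_mat_def)
  have "prod_mat ds (\<lambda>l. if l = k then A else 1\<^sub>m (ds ! l)) $$ (a,b)
    = A $$ (digit ds k a, digit ds k b) *
      (\<Prod>l\<in>{..<length ds} - {k}. (if l = k then A else 1\<^sub>m (ds ! l)) $$ (digit ds l a, digit ds l b))"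
    using ab k by (subst prod_mat_index, simp, simp, subst prod.remove[of _ k]) auto
  also have "(\<Prod>l\<in>{..<length ds} - {k}. (if l = k then A else 1\<^sub>m (ds ! l)) $$ (digit ds l a, digit ds l b))
     = (\<Prod>l\<in>{..<length ds} - {k}. if digit ds l a = digit ds l b then 1 else 0)"
    using digit_less[OF ds] by (intro prod.cong) auto
  also have "\<dots> = (if \<forall>l<length ds. l \<noteq> k \<longrightarrow> digit ds l a = digit ds l b then 1 else 0)"
  proof (cases "\<forall>l<length ds. l \<noteq> k \<longrightarrow> digit ds l a = digit ds l b")
    case False
    then show ?thesis by (subst if_not_P, simp) (auto intro!: prod_zero)
  qed (auto intro!: prod.neutral)
  finally show "loc ds k A $$ (a,b) = prod_mat ds (\<lambda>l. if l = k then A else 1\<^sub>m (ds ! l)) $$ (a,b)"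
    using ab by (cases "\<forall>l<length ds. l \<noteq> k \<longrightarrow> digit ds l a = digit ds l b") (auto simp: loc_def)
qed (auto simp: prod_mat_def loc_def)

lemma adj_loc_mult_loc:
  assumes ds: "\<forall>d\<in>set ds. d > 0" and k: "k < length ds" and A: "A \<in> carrier_mat (ds ! k) (ds ! k)"
  shows "adj (loc ds k A) * loc ds k A = loc ds k (adj A * A)"
proof -
  have "adj (loc ds k A) * loc ds k A = prod_mat ds (\<lambda>l. adj (if l = k then A else 1\<^sub>m (ds ! l)) *
      (if l = k then A else 1\<^sub>m (ds ! l)))"
    unfolding loc_eq_prod_mat[OF ds k] using A
    by (subst adj_prod_mat[OF ds]) (auto simp: prod_mat_mult[OF ds])
  then show ?thesis unfolding loc_eq_prod_mat[OF ds k] by (auto intro!: prod_mat_cong)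
qed

lemma msum_loc:
  assumes ds: "\<forall>d\<in>set ds. d > 0" and k: "k < length ds"
  shows "msum (dimH ds) S (\<lambda>j. loc ds k (B j)) = loc ds k (msum (ds ! k) S B)"
  using digit_less[OF ds k] by (auto simp: msum_def loc_def intro!: eq_matI sum.neutral)

lemma loc_one:
  assumes ds: "\<forall>d\<in>set ds. d > 0" and k: "k < length ds"
  shows "loc ds k (1\<^sub>m (ds ! k)) = 1\<^sub>m (dimH ds)"
proof -
  have "loc ds k (1\<^sub>m (ds ! k)) = prod_mat ds (\<lambda>l. 1\<^sub>m (ds ! l))"
    unfolding loc_eq_prod_mat[OF ds k] by (rule prod_mat_cong) auto
  then show ?thesis using prod_mat_one[OF ds] by simp
qed

section \<open>LOCC effects are separable\<close>

text \<open>Unnormalised separable operators. LOCC effects need not have trace one, so normalisation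
  is postponed until after the induction over the protocol.\<close>

inductive sep_cone :: "nat list \<Rightarrow> complex mat \<Rightarrow> bool" for ds where
  zero: "sep_cone ds (0\<^sub>m (dimH ds) (dimH ds))"
| add: "sep_cone ds A \<Longrightarrow> (\<forall>l<length ds. psd (ds ! l) (\<rho> l)) \<Longrightarrow> sep_cone ds (A + prod_mat ds \<rho>)"

lemma sep_cone_carrier: "sep_cone ds A \<Longrightarrow> A \<in> carrier_mat (dimH ds) (dimH ds)"
  by (induction rule: sep_cone.induct) auto

lemma sep_cone_plus: "sep_cone ds B \<Longrightarrow> sep_cone ds A \<Longrightarrow> sep_cone ds (A + B)"
proof (induction rule: sep_cone.induct)
  case zero
  then show ?case using sep_cone_carrier[OF zero] by simp
next
  case (add B \<rho>)
  then have "sep_cone ds ((A + B) + prod_mat ds \<rho>)" by (intro sep_cone.add) auto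
  then show ?case using sep_cone_carrier[OF add.prems] sep_cone_carrier[OF add.hyps(1)]
    by (subst assoc_add_mat[symmetric]) auto
qed

lemma msum_carrier [simp]: "msum n S f \<in> carrier_mat n n"
  by (simp add: msum_def)

lemma msum_insert:
  assumes "finite S" "j \<notin> S" "f j \<in> carrier_mat n n"
  shows "msum n (insert j S) f = msum n S f + f j"
  using assms by (auto simp: msum_def)

lemma sep_cone_msum:
  assumes "finite S" "\<forall>j\<in>S. sep_cone ds (f j)"
  shows "sep_cone ds (msum (dimH ds) S f)"
  using assms
proof (induction rule: finite_induct)
  case empty
  have "msum (dimH ds) {} f = 0\<^sub>m (dimH ds) (dimH ds)" by (auto simp: msum_def)
  then show ?case by (simp add: sep_cone.zero)
next
  case (insert j S)
  then show ?case
    using sep_cone_plus[of ds "f j" "msum (dimH ds) S f"] sep_cone_carrier[of ds "f j"]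
    by (simp add: msum_insert)
qed

text \<open>Conjugating a product operator by a product operator conjugates each factor separately,
  and each factor stays positive. This is what one round of a protocol does to an effect.\<close>

lemma sep_cone_conj:
  assumes "sep_cone ds A" and ds: "\<forall>d\<in>set ds. d > 0"
    and L: "\<And>l. l < length ds \<Longrightarrow> L l \<in> carrier_mat (ds ! l) (ds ! l)"
  shows "sep_cone ds (adj (prod_mat ds L) * A * prod_mat ds L)"
  using assms(1)
proof (induction rule: sep_cone.induct)
  case zero
  then show ?case using left_mult_zero_mat[OF prod_mat_carrier] right_mult_zero_mat[OF adj_carrier[OF prod_mat_carrier]]
    by (simp add: sep_cone.zero)
next
  case (add A \<rho>)
  let ?L = "prod_mat ds L" and ?\<rho> = "prod_mat ds \<rho>" and ?D = "dimH ds"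
  have \<rho>: "\<rho> l \<in> carrier_mat (ds ! l) (ds ! l)" if "l < length ds" for l
    using add.hyps(2) that by (auto dest: psdD)
  have c: "A \<in> carrier_mat ?D ?D" "?L \<in> carrier_mat ?D ?D" "adj ?L \<in> carrier_mat ?D ?D" "?\<rho> \<in> carrier_mat ?D ?D"
    using sep_cone_carrier[OF add.hyps(1)] by simp_all
  have "adj ?L * (A + ?\<rho>) * ?L = adj ?L * A * ?L + adj ?L * ?\<rho> * ?L"
    by (simp only: mult_add_distrib_mat[OF c(3,1,4)]
      add_mult_distrib_mat[OF mult_carrier_mat[OF c(3,1)] mult_carrier_mat[OF c(3,4)] c(2)])
  also have "adj ?L * ?\<rho> * ?L = prod_mat ds (\<lambda>l. adj (L l) * \<rho> l * L l)"
  proof -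
    have L': "adj (L l) \<in> carrier_mat (ds ! l) (ds ! l)" if "l < length ds" for l using L[OF that] by simp
    have "adj ?L * ?\<rho> = prod_mat ds (\<lambda>l. adj (L l) * \<rho> l)"
      by (subst adj_prod_mat[OF ds], erule L, rule prod_mat_mult[OF ds L' \<rho>])
    then show ?thesis
      using prod_mat_mult[OF ds mult_carrier_mat[OF L' \<rho>] L] by simp
  qed
  finally show ?case
    using sep_cone.add[OF add.IH, of "\<lambda>l. adj (L l) * \<rho> l * L l"] add.hyps(2) psd_conj L by auto
qed

lemma msum_conj:
  assumes "finite S" "\<forall>j\<in>S. f j \<in> carrier_mat n n" "A \<in> carrier_mat n n" "B \<in> carrier_mat n n"
  shows "msum n S (\<lambda>j. A * f j * B) = A * msum n S f * B"
  using assms(1,2)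
proof (induction rule: finite_induct)
  case empty
  have "msum n {} g = 0\<^sub>m n n" for g by (auto simp: msum_def)
  then show ?case using assms by simp
next
  case (insert j S)
  have c: "f j \<in> carrier_mat n n" using insert.prems by simp
  show ?case
    using insert.IH insert.hyps insert.prems assms(3,4) c
      mult_add_distrib_mat[OF assms(3) msum_carrier c]
      add_mult_distrib_mat[OF mult_carrier_mat[OF assms(3) msum_carrier] mult_carrier_mat[OF assms(3) c] assms(4)]
    by (simp add: msum_insert)
qed

lemma msum_cong: "(\<And>j. j \<in> S \<Longrightarrow> f j = g j) \<Longrightarrow> msum n S f = msum n S g"
  by (simp add: msum_def)

text \<open>Positivity is carried along beside the cone, which avoids proving that a product of
  positive operators is positive. Completeness is needed later both for \<open>1 - P\<close> to be
  positive and for the traces to add up to the dimension.\<close>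

lemma locc_povm_effects:
  assumes "locc_povm ds n E" and ds: "\<forall>d\<in>set ds. d > 0"
  shows "(\<forall>i<n. psd (dimH ds) (E i) \<and> sep_cone ds (E i)) \<and> msum (dimH ds) {..<n} E = 1\<^sub>m (dimH ds)"
  using assms(1)
proof (induction rule: locc_povm.induct)
  case trivial
  have "0\<^sub>m (dimH ds) (dimH ds) + prod_mat ds (\<lambda>l. 1\<^sub>m (ds ! l)) = 1\<^sub>m (dimH ds)"
    unfolding prod_mat_one[OF ds] by simp
  then have "sep_cone ds (1\<^sub>m (dimH ds))"
    using sep_cone.add[OF sep_cone.zero, of ds "\<lambda>l. 1\<^sub>m (ds ! l)"] psd_one by simp
  moreover have "msum (dimH ds) {..<1::nat} (\<lambda>_. 1\<^sub>m (dimH ds)) = 1\<^sub>m (dimH ds)"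
    by (auto simp: msum_def)
  ultimately show ?case using psd_one by auto
next
  case (local_step k J K n F)
  let ?D = "dimH ds" and ?L = "\<lambda>j. loc ds k (K j)"
  let ?G = "\<lambda>j i. adj (?L j) * F j i * ?L j"
  note IH = local_step.IH
  have F: "psd ?D (F j i)" "sep_cone ds (F j i)" if "j < J" "i < n" for i j using IH that by auto
  have Fs: "msum ?D {..<n} (F j) = 1\<^sub>m ?D" if "j < J" for j using IH that by auto
  have "sep_cone ds (?G j i)" if "j < J" "i < n" for i j
    unfolding loc_eq_prod_mat[OF ds local_step.hyps(1)]
    by (rule sep_cone_conj[OF F(2)[OF that] ds]) (use local_step.hyps that in auto)
  then have "sep_cone ds (msum ?D {..<J} (\<lambda>j. ?G j i))" if "i < n" for i
    using that by (intro sep_cone_msum) auto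
  moreover have "psd ?D (msum ?D {..<J} (\<lambda>j. ?G j i))" if "i < n" for i
    using that F by (intro psd_msum) (auto intro: psd_conj)
  moreover have "msum ?D {..<n} (\<lambda>i. msum ?D {..<J} (\<lambda>j. ?G j i)) = 1\<^sub>m ?D"
  proof -
    \<comment> \<open>Sum over the final outcomes first: every continuation is complete, so the
      inner sum is the identity and only the Kraus relation of the acting party remains.\<close>
    have "msum ?D {..<n} (\<lambda>i. msum ?D {..<J} (\<lambda>j. ?G j i)) = msum ?D {..<J} (\<lambda>j. msum ?D {..<n} (\<lambda>i. ?G j i))"
      unfolding msum_def by (intro cong_mat refl) (auto intro: sum.swap)
    also have "\<dots> = msum ?D {..<J} (\<lambda>j. adj (?L j) * msum ?D {..<n} (F j) * ?L j)"
      using F by (intro msum_cong msum_conj) (auto dest: psdD)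
    also have "\<dots> = msum ?D {..<J} (\<lambda>j. loc ds k (adj (K j) * K j))"
    proof (rule msum_cong)
      fix j assume j: "j \<in> {..<J}"
      then show "adj (?L j) * msum ?D {..<n} (F j) * ?L j = loc ds k (adj (K j) * K j)"
        using Fs[of j] right_mult_one_mat[OF adj_carrier[OF loc_carrier], of ds k "K j"] local_step.hyps(3)
          adj_loc_mult_loc[OF ds local_step.hyps(1)] by simp
    qed
    also have "\<dots> = 1\<^sub>m ?D"
      unfolding msum_loc[OF ds local_step.hyps(1)] local_step.hyps(4) by (rule loc_one[OF ds local_step.hyps(1)])
    finally show ?thesis .
  qed
  ultimately show ?case by blast
next
  case (coarse n E g n')
  let ?D = "dimH ds"
  have "psd ?D (msum ?D {l. l < n \<and> g l = i} E)" "sep_cone ds (msum ?D {l. l < n \<and> g l = i} E)" for i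
    using coarse.IH by (auto intro!: psd_msum sep_cone_msum)
  moreover have "msum ?D {..<n'} (\<lambda>i. msum ?D {l. l < n \<and> g l = i} E) = msum ?D {..<n} E"
  proof -
    \<comment> \<open>The fibres of \<open>g\<close> partition the old outcomes, as \<open>g\<close>
      maps all of them below \<open>n'\<close>.\<close>
    have "(\<Sum>i<n'. \<Sum>l\<in>{l. l < n \<and> g l = i}. E l $$ (a,b)) = (\<Sum>l<n. E l $$ (a,b))" for a b
      using sum.group[of "{..<n}" "{..<n'}" g "\<lambda>l. E l $$ (a,b)"] coarse.hyps(2) by auto
    then show ?thesis by (auto simp: msum_def)
  qed
  ultimately show ?case using coarse.IH by auto
qed

section \<open>From positive operators to density matrices and separable states\<close>

lemma density_outer: "unit_vec_in n \<psi> \<Longrightarrow> density n (outer \<psi>)"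
  by (auto simp: density_def psd_def unit_vec_in_def outer_form mtrace_outer)

lemma density_exists:
  assumes "n > 0"
  shows "\<exists>\<rho>. density n \<rho>"
proof -
  have "ipr (unit_vec n 0) (unit_vec n 0) = (\<Sum>i<n. if i = 0 then 1 else 0)"
    unfolding ipr_def index_unit_vec by (rule sum.cong) auto
  also have "\<dots> = 1" using assms by (simp add: sum.delta')
  finally show ?thesis by (intro exI[of _ "outer (unit_vec n 0)"] density_outer) (auto simp: unit_vec_in_def)
qed

lemma mtrace_smult: "mtrace (c \<cdot>\<^sub>m A) = c * mtrace A" if "A \<in> carrier_mat n n"
  using that by (auto simp: mtrace_def sum_distrib_left)

lemma mtrace_add: "mtrace (A + B) = mtrace A + mtrace B"
  if "A \<in> carrier_mat n n" "B \<in> carrier_mat n n"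
  using that by (auto simp: mtrace_def sum.distrib)

lemma smult_mat_mult_vec:
  assumes "A \<in> carrier_mat n n" "v \<in> carrier_vec n"
  shows "(c \<cdot>\<^sub>m A) *\<^sub>v v = c \<cdot>\<^sub>v (A *\<^sub>v v)"
  using assms by (intro eq_vecI)
    (auto simp: mult_mat_vec_index[of _ n n] sum_distrib_left mult_ac simp del: index_mult_mat_vec)

lemma psd_smult:
  assumes "psd n A" "r \<ge> 0"
  shows "psd n (complex_of_real r \<cdot>\<^sub>m A)"
proof -
  note A = psdD[OF assms(1)]
  have "adj (complex_of_real r \<cdot>\<^sub>m A) = complex_of_real r \<cdot>\<^sub>m adj A"
    by (auto simp: adj_def)
  moreover have "Re (ipr v ((complex_of_real r \<cdot>\<^sub>m A) *\<^sub>v v)) \<ge> 0" if "v \<in> carrier_vec n" for v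
    using A assms(2) that
    by (simp add: smult_mat_mult_vec[of _ n] ipr_smult_right[of _ n] mult_mat_vec_carrier[OF A(1) that])
  ultimately show ?thesis using A by (simp add: psd_def)
qed

lemma psd_add:
  assumes "psd n A" "psd n B"
  shows "psd n (A + B)"
proof -
  note A = psdD[OF assms(1)] and B = psdD[OF assms(2)]
  have "adj (A + B) = adj A + adj B"
    using A(1) B(1) by (auto simp: adj_def)
  moreover have "Re (ipr v ((A + B) *\<^sub>v v)) \<ge> 0" if "v \<in> carrier_vec n" for v
    using A B that
    by (simp add: add_mult_distrib_mat_vec[of _ n n] ipr_add[of _ n] mult_mat_vec_carrier[OF A(1) that]
        mult_mat_vec_carrier[OF B(1) that])
  ultimately show ?thesis using A B by (simp add: psd_def)
qed

lemma psd_normalize: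
  assumes "psd n A" "n > 0"
  shows "\<exists>r \<tau>. r \<ge> 0 \<and> density n \<tau> \<and> A = complex_of_real r \<cdot>\<^sub>m \<tau>"
proof (cases "mtrace A = 0")
  \<comment> \<open>A positive operator of trace zero is zero, so any density matrix with weight 0
    will do.\<close>
  case True
  then have A: "A = 0\<^sub>m n n" by (rule psd_trace_eq_0[OF assms(1)])
  obtain \<tau> where "density n \<tau>" using density_exists[OF assms(2)] by auto
  then show ?thesis using A
    by (intro exI[of _ 0] exI[of _ \<tau>]) (auto simp: density_def psd_def)
next
  case False
  define r where "r = Re (mtrace A)"
  have r: "mtrace A = complex_of_real r" "r > 0" "r \<noteq> 0"
    using psd_trace[OF assms(1)] False by (auto simp: r_def order.order_iff_strict)
  have "density n (complex_of_real (1 / r) \<cdot>\<^sub>m A)"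
    unfolding density_def using psd_smult[OF assms(1), of "1 / r"] r
      mtrace_smult[OF psdD(1)[OF assms(1)], of "complex_of_real (1 / r)"] by simp
  moreover have "A = complex_of_real r \<cdot>\<^sub>m (complex_of_real (1 / r) \<cdot>\<^sub>m A)" using r by (intro eq_matI) auto
  ultimately show ?thesis using r(2) by (intro exI[of _ r] exI[of _ "complex_of_real (1 / r) \<cdot>\<^sub>m A"]) auto
qed

text \<open>Each positive factor is its trace times a density matrix; the product of these scalars
  becomes the weight of the term.\<close>

lemma sep_cone_decompose:
  assumes "sep_cone ds A" and ds: "\<forall>d\<in>set ds. d > 0"
  shows "\<exists>(K::nat) p \<rho>s. (\<forall>j<K. p j \<ge> (0::real) \<and> (\<forall>l<length ds. density (ds ! l) (\<rho>s j l))) \<and>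
    A = mat (dimH ds) (dimH ds) (\<lambda>(a,b). \<Sum>j<K. complex_of_real (p j) * prod_mat ds (\<rho>s j) $$ (a,b))"
  using assms(1)
proof (induction rule: sep_cone.induct)
  case zero
  show ?case by (intro exI[of _ 0]) auto
next
  case (add A \<rho>)
  obtain K :: nat and p :: "nat \<Rightarrow> real" and \<rho>s
    where p: "\<forall>j<K. p j \<ge> 0 \<and> (\<forall>l<length ds. density (ds ! l) (\<rho>s j l))"
    and A: "A = mat (dimH ds) (dimH ds) (\<lambda>(a,b). \<Sum>j<K. complex_of_real (p j) * prod_mat ds (\<rho>s j) $$ (a,b))"
    using add.IH by blast
  have "\<forall>l. l < length ds \<longrightarrow> (\<exists>r \<tau>. r \<ge> 0 \<and> density (ds ! l) \<tau> \<and> \<rho> l = complex_of_real r \<cdot>\<^sub>m \<tau>)"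
    using psd_normalize add.hyps(2) nth_pos[OF ds] by blast
  then obtain r \<tau> where r: "\<And>l. l < length ds \<Longrightarrow> r l \<ge> 0 \<and> density (ds ! l) (\<tau> l) \<and> \<rho> l = complex_of_real (r l) \<cdot>\<^sub>m \<tau> l"
    by metis
  define q where "q = (\<Prod>l<length ds. r l)"
  have q: "q \<ge> 0" unfolding q_def using r by (intro prod_nonneg) auto
  have "prod_mat ds \<rho> $$ (a,b) = complex_of_real q * prod_mat ds \<tau> $$ (a,b)" if "a < dimH ds" "b < dimH ds" for a b
  proof -
    have "\<rho> l $$ (digit ds l a, digit ds l b) = complex_of_real (r l) * \<tau> l $$ (digit ds l a, digit ds l b)"
      if "l < length ds" for l
    proof -
      have "\<tau> l \<in> carrier_mat (ds ! l) (ds ! l)" using r[OF that] by (auto simp: density_def psd_def)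
      then show ?thesis using r[OF that] digit_less[OF ds that] by simp
    qed
    then have "(\<Prod>l<length ds. \<rho> l $$ (digit ds l a, digit ds l b))
      = (\<Prod>l<length ds. complex_of_real (r l) * \<tau> l $$ (digit ds l a, digit ds l b))" by (intro prod.cong) auto
    then show ?thesis using that by (simp add: prod_mat_index prod.distrib q_def)
  qed
  then show ?case using p q r A
    by (intro exI[of _ "Suc K"] exI[of _ "p(K := q)"] exI[of _ "\<rho>s(K := \<tau>)"] conjI)
      (auto simp: less_Suc_eq carrier_matD[OF prod_mat_carrier] intro!: eq_matI)
qed

text \<open>Products of density matrices have trace one, so the weights add up to the trace of
  \<open>A\<close>; dividing by it makes the combination convex.\<close>

lemma sep_cone_separable:
  assumes A: "sep_cone ds A" and ds: "\<forall>d\<in>set ds. d > 0"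
    and t: "mtrace A = complex_of_real t" "t > 0"
  shows "separable ds (complex_of_real (1 / t) \<cdot>\<^sub>m A)"
proof -
  obtain K :: nat and p :: "nat \<Rightarrow> real" and \<rho>s
    where p: "\<forall>j<K. p j \<ge> 0 \<and> (\<forall>l<length ds. density (ds ! l) (\<rho>s j l))"
    and Ae: "A = mat (dimH ds) (dimH ds) (\<lambda>(a,b). \<Sum>j<K. complex_of_real (p j) * prod_mat ds (\<rho>s j) $$ (a,b))"
    using sep_cone_decompose[OF A ds] by blast
  have "mtrace A = (\<Sum>a<dimH ds. \<Sum>j<K. complex_of_real (p j) * prod_mat ds (\<rho>s j) $$ (a,a))"
    by (auto simp: mtrace_def Ae)
  also have "\<dots> = (\<Sum>j<K. \<Sum>a<dimH ds. complex_of_real (p j) * prod_mat ds (\<rho>s j) $$ (a,a))" by (rule sum.swap)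
  also have "\<dots> = (\<Sum>j<K. complex_of_real (p j) * mtrace (prod_mat ds (\<rho>s j)))"
    by (simp add: mtrace_def sum_distrib_left carrier_matD[OF prod_mat_carrier])
  also have "\<dots> = (\<Sum>j<K. complex_of_real (p j))"
  proof (intro sum.cong refl)
    fix j assume "j \<in> {..<K}"
    then have "\<And>l. l < length ds \<Longrightarrow> \<rho>s j l \<in> carrier_mat (ds ! l) (ds ! l) \<and> mtrace (\<rho>s j l) = 1"
      using p by (auto simp: density_def psd_def)
    then show "complex_of_real (p j) * mtrace (prod_mat ds (\<rho>s j)) = complex_of_real (p j)"
      by (simp add: mtrace_prod_mat[OF ds])
  qed
  finally have "(\<Sum>j<K. p j) = t" using t by (metis of_real_eq_iff of_real_sum)
  then have "(\<Sum>j<K. p j / t) = 1" using t by (simp add: sum_divide_distrib[symmetric])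
  then show ?thesis unfolding separable_def
    using p t(2) Ae by (intro exI[of _ K] exI[of _ "\<lambda>j. p j / t"] exI[of _ \<rho>s])
      (auto simp: sum_divide_distrib intro!: eq_matI)
qed

section \<open>Robustness\<close>

text \<open>Named so that nonemptiness, on which the meaning of \<open>Inf\<close> depends, can be
  passed on as a membership.\<close>

definition rob_set :: "nat list \<Rightarrow> complex mat \<Rightarrow> real set" where
  "rob_set ds \<sigma> = {t. t \<ge> 0 \<and> (\<exists>\<rho>. density (dimH ds) \<rho> \<and>
      separable ds (complex_of_real (1 / (1 + t)) \<cdot>\<^sub>m (\<sigma> + complex_of_real t \<cdot>\<^sub>m \<rho>)))}"

lemma rob_eq_Inf: "rob ds \<psi> = Inf (rob_set ds (outer \<psi>))"
  by (simp add: rob_def rob_g_def rob_set_def)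

text \<open>The noise is the normalised remainder \<open>P - outer \<psi>\<close>. Its weight
  \<open>r\<close> may be 0, and comparing traces gives \<open>1 + r\<close> for the trace of
  \<open>P\<close>.\<close>

lemma effect_trace_in_rob_set:
  assumes ds: "\<forall>d\<in>set ds. d > 0" and P: "psd (dimH ds) P" "sep_cone ds P"
    and \<psi>: "unit_vec_in (dimH ds) \<psi>" and eig: "P *\<^sub>v \<psi> = \<psi>"
  shows "Re (mtrace P) - 1 \<in> rob_set ds (outer \<psi>)"
proof -
  let ?D = "dimH ds"
  have D: "?D > 0" using ds unfolding dimH_eq_prod by (intro prod_pos) simp
  have \<psi>c: "\<psi> \<in> carrier_vec ?D" "ipr \<psi> \<psi> = 1" using \<psi> by (auto simp: unit_vec_in_def)
  obtain r \<tau> where r: "r \<ge> 0" "density ?D \<tau>" "P - outer \<psi> = complex_of_real r \<cdot>\<^sub>m \<tau>"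
    using psd_normalize[OF psd_minus_outer[OF P(1) \<psi> eig] D] by auto
  have \<tau>: "\<tau> \<in> carrier_mat ?D ?D" "mtrace \<tau> = 1" using r(2) by (auto simp: density_def psd_def)
  have "P = outer \<psi> + (P - outer \<psi>)" using psdD(1)[OF P(1)] outer_carrier[OF \<psi>c(1)] by auto
  then have Pe: "P = outer \<psi> + complex_of_real r \<cdot>\<^sub>m \<tau>" using r(3) by simp
  have tr: "mtrace P = complex_of_real (1 + r)"
    using \<tau> \<psi>c unfolding Pe
    by (subst mtrace_add[of _ ?D]) (auto simp: mtrace_outer mtrace_smult[of _ ?D])
  have "separable ds (complex_of_real (1 / (1 + r)) \<cdot>\<^sub>m P)"
    by (rule sep_cone_separable[OF P(2) ds tr]) (use r in auto)
  then show ?thesis using r tr Pe by (auto simp: rob_set_def)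
qed

section \<open>Relative entropy with respect to a pure state\<close>

text \<open>\<open>rel_ent\<close> may select any spectral decomposition of the projector, so all of
  them must be known. A nonzero eigenvalue forces its eigenvector to be \<open>\<psi>\<close> up to
  a phase, hence the eigenvalue is 1; the trace leaves room for only one such index.\<close>

lemma pure_eigdec:
  assumes e: "eigdec n (outer \<psi>) a f" and \<psi>: "unit_vec_in n \<psi>"
  shows "\<exists>j0<n. a j0 = 1 \<and> (\<forall>j<n. j \<noteq> j0 \<longrightarrow> a j = 0) \<and> (\<exists>c. cmod c = 1 \<and> f j0 = c \<cdot>\<^sub>v \<psi>)"
proof -
  have \<psi>c: "\<psi> \<in> carrier_vec n" "ipr \<psi> \<psi> = 1" using \<psi> by (auto simp: unit_vec_in_def)
  note fc = eigdec_carrier[OF e]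
  have ae: "a j = (cmod (ipr \<psi> (f j)))\<^sup>2" if "j < n" for j
    using eigdec_eigenvalue[OF e that] outer_form[OF \<psi>c(1) fc[OF that]] by (metis of_real_eq_iff)
  have key: "a j = 1 \<and> (\<exists>c. cmod c = 1 \<and> f j = c \<cdot>\<^sub>v \<psi>)" if j: "j < n" and nz: "a j \<noteq> 0" for j
  proof -
    define c where "c = ipr \<psi> (f j) / complex_of_real (a j)"
    have "ipr \<psi> (f j) \<cdot>\<^sub>v \<psi> = complex_of_real (a j) \<cdot>\<^sub>v f j"
      using eigdec_eigenvector[OF e j] outer_mult_vec[OF \<psi>c(1) fc[OF j]] by simp
    then have "inverse (complex_of_real (a j)) \<cdot>\<^sub>v (ipr \<psi> (f j) \<cdot>\<^sub>v \<psi>)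
        = inverse (complex_of_real (a j)) \<cdot>\<^sub>v (complex_of_real (a j) \<cdot>\<^sub>v f j)" by simp
    then have f: "f j = c \<cdot>\<^sub>v \<psi>"
      using nz by (simp add: smult_smult_assoc c_def divide_inverse mult.commute)
    have "1 = ipr (f j) (f j)" using orthonormalD(2)[OF eigdecD(1)[OF e] j j] by simp
    also have "\<dots> = c * cnj c"
      unfolding f using \<psi>c by (simp add: ipr_smult_left[of _ n] ipr_smult_right[of _ n] mult.commute)
    finally have "complex_of_real ((cmod c)\<^sup>2) = 1" by (simp only: complex_norm_square)
    then have c2: "(cmod c)\<^sup>2 = 1" by (metis of_real_eq_1_iff)
    then have "cmod c = 1" by (simp add: power2_eq_1_iff) (metis norm_ge_zero not_one_le_zero neg_0_le_iff_le)
    moreover have "a j = 1" unfolding ae[OF j] f using \<psi>c c2 by (simp add: ipr_smult_right[of _ n])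
    ultimately show ?thesis using f by blast
  qed
  have s: "(\<Sum>j<n. a j) = 1"
    using eigdec_trace[OF e] mtrace_outer[OF \<psi>c(1)] \<psi>c(2) by (metis of_real_eq_1_iff)
  then obtain j0 where j0: "j0 < n" "a j0 \<noteq> 0" by (metis lessThan_iff sum.neutral zero_neq_one)
  have "(\<Sum>j<n. a j) = a j0 + (\<Sum>j\<in>{..<n} - {j0}. a j)" using j0 by (subst sum.remove[of _ j0]) auto
  then have "(\<Sum>j\<in>{..<n} - {j0}. a j) = 0" using s key[OF j0] by simp
  then have "\<forall>j\<in>{..<n} - {j0}. a j = 0" by (subst (asm) sum_nonneg_eq_0_iff) (auto simp: ae)
  then show ?thesis using key[OF j0] j0(1) by auto
qed

text \<open>The decomposition of \<open>\<omega>\<close> is the one hidden in the choice operator,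
  hence the existential. That of the projector disappears, because its phase drops out of the
  moduli.\<close>

lemma rel_ent_pure:
  assumes \<psi>: "unit_vec_in n \<psi>" and \<omega>: "density n \<omega>"
  shows "\<exists>lam e. eigdec n \<omega> lam e \<and> rel_ent n (outer \<psi>) \<omega> =
    (if \<exists>k<n. lam k = 0 \<and> ipr (e k) \<psi> \<noteq> 0 then \<infinity>
     else ereal (- (\<Sum>k<n. (cmod (ipr (e k) \<psi>))\<^sup>2 * log 2 (lam k))))"
proof -
  have \<psi>c: "\<psi> \<in> carrier_vec n" using \<psi> by (auto simp: unit_vec_in_def)
  let ?V = "\<lambda>a f lam e. if \<exists>j<n. \<exists>k<n. a j \<noteq> 0 \<and> lam k = 0 \<and> ipr (f j) (e k) \<noteq> 0 then \<infinity>
          else ereal (\<Sum>j<n. \<Sum>k<n. if a j = 0 then 0 else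
                 (cmod (ipr (f j) (e k)))\<^sup>2 * a j * (log 2 (a j) - log 2 (lam k)))"
  let ?P = "\<lambda>x. \<exists>a f lam e. eigdec n (outer \<psi>) a f \<and> eigdec n \<omega> lam e \<and> x = ?V a f lam e"
  obtain a0 f0 where "eigdec n (outer \<psi>) a0 f0"
    using hermitian_eigdec[OF outer_carrier[OF \<psi>c] adj_outer] by auto
  moreover obtain lam0 e0 where "eigdec n \<omega> lam0 e0"
    using psd_eigdec[of n \<omega>] \<omega> by (auto simp: density_def)
  ultimately have "\<exists>x. ?P x" by blast
  then have "?P (rel_ent n (outer \<psi>) \<omega>)" unfolding rel_ent_def by (rule someI_ex)
  then obtain a f lam e where af: "eigdec n (outer \<psi>) a f" and le: "eigdec n \<omega> lam e"
    and x: "rel_ent n (outer \<psi>) \<omega> = ?V a f lam e" by blast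
  obtain j0 c where j0: "j0 < n" "a j0 = 1" "\<And>j. j < n \<Longrightarrow> j \<noteq> j0 \<Longrightarrow> a j = 0"
    and c: "cmod c = 1" "f j0 = c \<cdot>\<^sub>v \<psi>" using pure_eigdec[OF af \<psi>] by blast
  have m: "cmod (ipr (f j0) (e k)) = cmod (ipr (e k) \<psi>)" if "k < n" for k
  proof -
    have ek: "e k \<in> carrier_vec n" using eigdec_carrier[OF le that] .
    have "ipr (f j0) (e k) = cnj c * cnj (ipr (e k) \<psi>)"
      unfolding c(2) using ek \<psi>c by (simp add: ipr_smult_left[of _ n] ipr_cnj[of _ n])
    then show ?thesis using c(1) by (simp add: norm_mult)
  qed
  then have z: "ipr (f j0) (e k) = 0 \<longleftrightarrow> ipr (e k) \<psi> = 0" if "k < n" for k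
    using that by (metis norm_eq_zero)
  have cond: "(\<exists>j<n. \<exists>k<n. a j \<noteq> 0 \<and> lam k = 0 \<and> ipr (f j) (e k) \<noteq> 0) \<longleftrightarrow> (\<exists>k<n. lam k = 0 \<and> ipr (e k) \<psi> \<noteq> 0)"
    using j0 z by (metis zero_neq_one)
  \<comment> \<open>Only \<open>j0\<close> survives, and there
    \<open>log 2 (a j0) = 0\<close>.\<close>
  have "(\<Sum>j<n. \<Sum>k<n. if a j = 0 then 0 else (cmod (ipr (f j) (e k)))\<^sup>2 * a j * (log 2 (a j) - log 2 (lam k)))
     = (\<Sum>j<n. if j = j0 then (\<Sum>k<n. (cmod (ipr (e k) \<psi>))\<^sup>2 * (- log 2 (lam k))) else 0)"
    using j0 m by (intro sum.cong refl) (auto intro!: sum.cong)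
  also have "\<dots> = - (\<Sum>k<n. (cmod (ipr (e k) \<psi>))\<^sup>2 * log 2 (lam k))"
    using j0(1) by (simp add: sum_negf)
  finally show ?thesis using le x cond by (intro exI[of _ lam] exI[of _ e]) auto
qed

text \<open>Sum the tangent bound \<open>ln (x k / S) \<le> x k / S - 1\<close> with weights
  \<open>p k\<close>; the right-hand sides cancel. Positivity is asked only where the weight is
  nonzero, since zero eigenvalues of a state may occur among the \<open>x k\<close>.\<close>

lemma jensen_log2:
  assumes "finite I" "\<And>k. k \<in> I \<Longrightarrow> p k \<ge> (0::real)" "(\<Sum>k\<in>I. p k) = 1"
    and x: "\<And>k. k \<in> I \<Longrightarrow> p k \<noteq> 0 \<Longrightarrow> x k > 0"
  shows "(\<Sum>k\<in>I. p k * x k) > 0" "(\<Sum>k\<in>I. p k * log 2 (x k)) \<le> log 2 (\<Sum>k\<in>I. p k * x k)"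
proof -
  define S where "S = (\<Sum>k\<in>I. p k * x k)"
  have nn: "p k * x k \<ge> 0" if "k \<in> I" for k
    using assms(2)[OF that] x[OF that] by (cases "p k = 0") auto
  obtain k where k: "k \<in> I" "p k \<noteq> 0" using assms(3) by (metis sum.neutral zero_neq_one)
  have "p k * x k > 0" using assms(2)[OF k(1)] x[OF k] k(2) by auto
  then show S: "S > 0" unfolding S_def using nn k(1) assms(1) by (intro sum_pos2[of _ k]) auto
  have "p k * ln (x k) \<le> p k * (ln S - 1) + p k * x k / S" if "k \<in> I" for k
  proof (cases "p k = 0")
    case False
    then have xk: "x k > 0" using x[OF that] by simp
    have "ln (x k / S) \<le> x k / S - 1" using xk S by (intro ln_le_minus_one) simp
    then have "ln (x k) \<le> ln S - 1 + x k / S" using xk S by (simp add: ln_div)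
    then have "p k * ln (x k) \<le> p k * (ln S - 1 + x k / S)" using assms(2)[OF that] by (rule mult_left_mono)
    then show ?thesis by (simp add: algebra_simps)
  qed simp
  then have "(\<Sum>k\<in>I. p k * ln (x k)) \<le> (\<Sum>k\<in>I. p k * (ln S - 1) + p k * x k / S)" by (rule sum_mono)
  also have "\<dots> = (\<Sum>k\<in>I. p k) * (ln S - 1) + S / S"
    by (simp add: sum.distrib sum_distrib_right[symmetric] sum_divide_distrib[symmetric] S_def)
  also have "\<dots> = ln S" using S assms(3) by simp
  finally have "(\<Sum>k\<in>I. p k * ln (x k)) / ln 2 \<le> ln S / ln 2" by (rule divide_right_mono) simp
  then show "(\<Sum>k\<in>I. p k * log 2 (x k)) \<le> log 2 S"
    by (simp add: log_def sum_divide_distrib)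
qed

text \<open>If \<open>s \<omega> \<ge> \<psi>\<psi>\<^sup>*\<close>, testing with \<open>v = \<omega>\<^sup>-\<^sup>1\<psi>\<close> gives \<open>\<langle>\<psi>, \<omega>\<^sup>-\<^sup>1\<psi>\<rangle> \<le> s\<close>,
  and Jensen's inequality bounds the relative entropy by the logarithm of the left-hand side.\<close>

lemma rel_ent_pure_le:
  assumes \<psi>: "unit_vec_in n \<psi>" and \<omega>: "density n \<omega>" and s: "s > 0"
    and dom: "\<And>v. v \<in> carrier_vec n \<Longrightarrow> (cmod (ipr \<psi> v))\<^sup>2 \<le> s * Re (ipr v (\<omega> *\<^sub>v v))"
  shows "rel_ent n (outer \<psi>) \<omega> \<le> ereal (log 2 s)"
proof -
  have \<psi>c: "\<psi> \<in> carrier_vec n" "ipr \<psi> \<psi> = 1" using \<psi> by (auto simp: unit_vec_in_def)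
  obtain lam e where e: "eigdec n \<omega> lam e" and R: "rel_ent n (outer \<psi>) \<omega> =
    (if \<exists>k<n. lam k = 0 \<and> ipr (e k) \<psi> \<noteq> 0 then \<infinity>
     else ereal (- (\<Sum>k<n. (cmod (ipr (e k) \<psi>))\<^sup>2 * log 2 (lam k))))"
    using rel_ent_pure[OF \<psi> \<omega>] by blast
  note ec = eigdec_carrier[OF e] and on = eigdecD(1)[OF e]
  have nn: "lam k \<ge> 0" if "k < n" for k
    using psd_eigdec_nonneg[OF _ e that] \<omega> by (simp add: density_def)
  define p where "p k = (cmod (ipr (e k) \<psi>))\<^sup>2" for k
  have p1: "(\<Sum>k<n. p k) = 1" using parseval[OF on \<psi>c(1)] \<psi>c(2) by (simp add: p_def)
  have sym: "cmod (ipr \<psi> (e k)) = cmod (ipr (e k) \<psi>)" if "k < n" for k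
    using ipr_cnj[OF \<psi>c(1) ec[OF that]] by (metis complex_mod_cnj)
  \<comment> \<open>Testing \<open>dom\<close> on a kernel vector of \<open>\<omega>\<close> shows
    that \<open>\<psi>\<close> has no component there, which rules out the infinite value.\<close>
  have ker: "ipr (e k) \<psi> = 0" if "k < n" "lam k = 0" for k
  proof -
    have "(cmod (ipr (e k) \<psi>))\<^sup>2 \<le> s * Re (ipr (e k) (\<omega> *\<^sub>v e k))"
      using dom[OF ec[OF that(1)]] sym[OF that(1)] by simp
    also have "\<dots> = 0" using eigdec_eigenvalue[OF e that(1)] that(2) by simp
    finally show ?thesis by simp
  qed
  have pos: "inverse (lam k) > 0" if "k < n" "p k \<noteq> 0" for k
    using nn[OF that(1)] ker[OF that(1)] that(2) by (cases "lam k = 0") (auto simp: p_def)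
  define S where "S = (\<Sum>k<n. p k * inverse (lam k))"
  have J: "S > 0" "(\<Sum>k<n. p k * log 2 (inverse (lam k))) \<le> log 2 S"
    unfolding S_def by (rule jensen_log2; use p1 pos in \<open>simp add: p_def\<close>)+
  \<comment> \<open>This is the pseudo-inverse of \<open>\<omega>\<close> applied to
    \<open>\<psi>\<close>, since \<open>inverse 0 = 0\<close>; it makes both sides of
    \<open>dom\<close> computable in terms of \<open>S\<close>.\<close>
  define v where "v = lincomb n n (\<lambda>k. ipr (e k) \<psi> * inverse (lam k)) e"
  have v: "v \<in> carrier_vec n" by (simp add: v_def)
  have ev: "ipr (e k) v = ipr (e k) \<psi> * inverse (lam k)" if "k < n" for k
    unfolding v_def using that orthonormalD(2)[OF on that]
    by (subst ipr_lincomb_right[OF ec]) (auto simp: sum_mult_delta)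
  have "ipr \<psi> v = (\<Sum>k<n. complex_of_real (p k * inverse (lam k)))"
    unfolding v_def
  proof (subst ipr_lincomb_right[OF ec], assumption, intro sum.cong refl)
    fix k assume "k \<in> {..<n}"
    then have "ipr \<psi> (e k) = cnj (ipr (e k) \<psi>)" using ipr_cnj[OF ec \<psi>c(1)] by simp
    then show "ipr (e k) \<psi> * complex_of_real (inverse (lam k)) * ipr \<psi> (e k) = complex_of_real (p k * inverse (lam k))"
      by (simp only: p_def of_real_mult complex_norm_square mult_ac)
  qed
  then have "ipr \<psi> v = complex_of_real S" by (simp add: S_def)
  then have "S\<^sup>2 = (cmod (ipr \<psi> v))\<^sup>2" by simp
  also have "\<dots> \<le> s * Re (ipr v (\<omega> *\<^sub>v v))" by (rule dom[OF v])
  also have "Re (ipr v (\<omega> *\<^sub>v v)) = (\<Sum>k<n. lam k * (cmod (ipr (e k) v))\<^sup>2)"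
    unfolding eigdec_form[OF e v] by simp
  also have "\<dots> = S"
    unfolding S_def
  proof (intro sum.cong refl)
    fix k assume "k \<in> {..<n}"
    then have "(cmod (ipr (e k) v))\<^sup>2 = p k * (inverse (lam k))\<^sup>2"
      by (simp add: ev p_def norm_mult power_mult_distrib norm_inverse power_inverse)
    then show "lam k * (cmod (ipr (e k) v))\<^sup>2 = p k * inverse (lam k)"
      by (cases "lam k = 0") (simp_all add: power2_eq_square)
  qed
  \<comment> \<open>The chain reads \<open>S\<^sup>2 \<le> s * S\<close>, and the positive
    \<open>S\<close> cancels.\<close>
  finally have "S \<le> s" using J(1) by (simp add: power2_eq_square)
  then have "log 2 S \<le> log 2 s" using J(1) by simp
  moreover have "- (\<Sum>k<n. p k * log 2 (lam k)) = (\<Sum>k<n. p k * log 2 (inverse (lam k)))"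
    by (simp add: log_def ln_inverse sum_negf)
  ultimately show ?thesis using J(2) ker unfolding R by (auto simp: p_def)
qed

text \<open>Jensen's inequality applied to the eigenvalues themselves, whose mean is the overlap. An
  upper bound \<open>q\<close> is allowed so that a supremum can be inserted; in the finite case
  \<open>q\<close> is positive because the mean is.\<close>

lemma rel_ent_pure_ge:
  assumes \<psi>: "unit_vec_in n \<psi>" and \<omega>: "density n \<omega>"
    and q: "Re (ipr \<psi> (\<omega> *\<^sub>v \<psi>)) \<le> q"
  shows "ereal (- log 2 q) \<le> rel_ent n (outer \<psi>) \<omega>"
proof -
  have \<psi>c: "\<psi> \<in> carrier_vec n" "ipr \<psi> \<psi> = 1" using \<psi> by (auto simp: unit_vec_in_def)
  obtain lam e where e: "eigdec n \<omega> lam e" and R: "rel_ent n (outer \<psi>) \<omega> =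
    (if \<exists>k<n. lam k = 0 \<and> ipr (e k) \<psi> \<noteq> 0 then \<infinity>
     else ereal (- (\<Sum>k<n. (cmod (ipr (e k) \<psi>))\<^sup>2 * log 2 (lam k))))"
    using rel_ent_pure[OF \<psi> \<omega>] by blast
  have nn: "lam k \<ge> 0" if "k < n" for k
    using psd_eigdec_nonneg[OF _ e that] \<omega> by (simp add: density_def)
  define p where "p k = (cmod (ipr (e k) \<psi>))\<^sup>2" for k
  have p1: "(\<Sum>k<n. p k) = 1"
    using parseval[OF eigdecD(1)[OF e] \<psi>c(1)] \<psi>c(2) by (simp add: p_def)
  show ?thesis
  proof (cases "\<exists>k<n. lam k = 0 \<and> ipr (e k) \<psi> \<noteq> 0")
    case False
    have pos: "lam k > 0" if "k < n" "p k \<noteq> 0" for k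
      using nn[OF that(1)] False that by (cases "lam k = 0") (auto simp: p_def)
    define S where "S = (\<Sum>k<n. p k * lam k)"
    have J: "S > 0" "(\<Sum>k<n. p k * log 2 (lam k)) \<le> log 2 S"
      unfolding S_def by (rule jensen_log2; use p1 pos in \<open>simp add: p_def\<close>)+
    have "S = Re (ipr \<psi> (\<omega> *\<^sub>v \<psi>))"
      unfolding eigdec_form[OF e \<psi>c(1)] by (simp add: S_def p_def mult.commute)
    then have "log 2 S \<le> log 2 q" using J(1) q by simp
    then show ?thesis using J(2) False unfolding R by (simp add: p_def)
  qed (simp add: R)
qed

section \<open>Overlaps with product vectors\<close>

definition overlaps :: "nat list \<Rightarrow> complex vec \<Rightarrow> real set" where
  "overlaps ds \<psi> = {(cmod (ipr (prod_vec ds \<phi>s) \<psi>))\<^sup>2 | \<phi>s.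
                  \<forall>l<length ds. unit_vec_in (ds ! l) (\<phi>s l)}"

lemma E_g_eq: "E_g ds \<psi> = - log 2 (Sup (overlaps ds \<psi>))"
  by (simp add: E_g_def overlaps_def)

lemma unit_vec_entry_le:
  assumes "unit_vec_in n v" "i < n"
  shows "cmod (v $ i) \<le> 1"
proof -
  have v: "v \<in> carrier_vec n" "ipr v v = 1" using assms by (auto simp: unit_vec_in_def)
  have "(cmod (v $ i))\<^sup>2 \<le> (\<Sum>i<n. (cmod (v $ i))\<^sup>2)"
    using assms(2) by (intro member_le_sum) auto
  also have "\<dots> = 1" using ipr_self[OF v(1)] v(2) by (metis of_real_eq_1_iff)
  finally show ?thesis by (simp add: power2_le_imp_le abs_square_le_1)
qed

text \<open>Only some bound is needed, to make \<open>Sup\<close> usable. Entries of unit vectors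
  have modulus at most 1, so the sum of the moduli of the entries of \<open>\<psi>\<close> bounds
  every inner product.\<close>

lemma overlaps_bdd:
  assumes ds: "\<forall>d\<in>set ds. d > 0" and \<psi>: "\<psi> \<in> carrier_vec (dimH ds)"
  shows "bdd_above (overlaps ds \<psi>)"
proof (rule bdd_aboveI)
  fix x assume "x \<in> overlaps ds \<psi>"
  then obtain \<phi>s where \<phi>: "\<forall>l<length ds. unit_vec_in (ds ! l) (\<phi>s l)"
    and x: "x = (cmod (ipr (prod_vec ds \<phi>s) \<psi>))\<^sup>2" by (auto simp: overlaps_def)
  have "cmod (prod_vec ds \<phi>s $ a) \<le> 1" if "a < dimH ds" for a
  proof -
    have "cmod (prod_vec ds \<phi>s $ a) = (\<Prod>l<length ds. cmod (\<phi>s l $ digit ds l a))"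
      using that by (simp add: prod_vec_def prod_norm)
    also have "\<dots> \<le> 1" using \<phi> digit_less[OF ds] by (intro prod_le_1) (auto intro: unit_vec_entry_le)
    finally show ?thesis .
  qed
  then have "cmod (ipr (prod_vec ds \<phi>s) \<psi>) \<le> (\<Sum>a<dimH ds. cmod (\<psi> $ a))"
    unfolding ipr_eq[OF \<psi>]
    by (intro sum_norm_le) (auto simp: norm_mult intro: mult_left_le_one_le)
  then show "x \<le> (\<Sum>a<dimH ds. cmod (\<psi> $ a))\<^sup>2" unfolding x by (intro power_mono) auto
qed

text \<open>Diagonalising every factor writes a product state as a convex combination of
  pure product states.\<close>

lemma product_state_overlap_le:
  assumes ds: "\<forall>d\<in>set ds. d > 0" and \<psi>: "\<psi> \<in> carrier_vec (dimH ds)"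
    and \<rho>: "\<And>l. l < length ds \<Longrightarrow> density (ds ! l) (\<rho> l)"
  shows "Re (ipr \<psi> (prod_mat ds \<rho> *\<^sub>v \<psi>)) \<le> Sup (overlaps ds \<psi>)"
proof -
  let ?D = "dimH ds"
  have "\<forall>l. \<exists>lam e. l < length ds \<longrightarrow> eigdec (ds ! l) (\<rho> l) lam e"
    using psd_eigdec \<rho> by (auto simp: density_def)
  then obtain lam e where e: "\<And>l. l < length ds \<Longrightarrow> eigdec (ds ! l) (\<rho> l) (lam l) (e l)" by metis
  have nn: "lam l k \<ge> 0" if "l < length ds" "k < ds ! l" for l k
    using psd_eigdec_nonneg[OF _ e[OF that(1)] that(2)] \<rho>[OF that(1)] by (simp add: density_def)
  have s1: "(\<Sum>k<ds ! l. lam l k) = 1" if "l < length ds" for l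
    using eigdec_trace[OF e[OF that]] \<rho>[OF that] by (metis density_def of_real_eq_1_iff)
  \<comment> \<open>A global index \<open>c\<close> encodes, through its digits, the choice of one
    eigenvector for each party.\<close>
  define w where "w c = (\<Prod>l<length ds. lam l (digit ds l c))" for c
  define \<phi> where "\<phi> c = prod_vec ds (\<lambda>l. e l (digit ds l c))" for c
  have \<phi>c: "\<phi> c \<in> carrier_vec ?D" for c by (simp add: \<phi>_def prod_vec_def)
  have dec: "prod_mat ds \<rho> = msum ?D {..<?D} (\<lambda>c. complex_of_real (w c) \<cdot>\<^sub>m outer (\<phi> c))"
  proof
    fix a b assume "a < dim_row (msum ?D {..<?D} (\<lambda>c. complex_of_real (w c) \<cdot>\<^sub>m outer (\<phi> c)))"
      "b < dim_col (msum ?D {..<?D} (\<lambda>c. complex_of_real (w c) \<cdot>\<^sub>m outer (\<phi> c)))"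
    then have ab: "a < ?D" "b < ?D" by (auto simp: msum_def)
    have "prod_mat ds \<rho> $$ (a,b) = (\<Prod>l<length ds. \<Sum>k<ds ! l.
        complex_of_real (lam l k) * e l k $ digit ds l a * cnj (e l k $ digit ds l b))"
      using ab digit_less[OF ds] by (simp add: prod_mat_index eigdecD(3)[OF e])
    also have "\<dots> = (\<Sum>c<?D. \<Prod>l<length ds.
        complex_of_real (lam l (digit ds l c)) * e l (digit ds l c) $ digit ds l a * cnj (e l (digit ds l c) $ digit ds l b))"
      by (rule sum_prod_digits[OF ds, symmetric])
    also have "\<dots> = msum ?D {..<?D} (\<lambda>c. complex_of_real (w c) \<cdot>\<^sub>m outer (\<phi> c)) $$ (a,b)"
      using ab by (simp add: msum_def outer_def carrier_vecD[OF \<phi>c] prod.distrib w_def)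
        (simp add: \<phi>_def prod_vec_def mult_ac)
    finally show "prod_mat ds \<rho> $$ (a,b) = msum ?D {..<?D} (\<lambda>c. complex_of_real (w c) \<cdot>\<^sub>m outer (\<phi> c)) $$ (a,b)" .
  qed (auto simp: prod_mat_def msum_def)
  have "ipr \<psi> (prod_mat ds \<rho> *\<^sub>v \<psi>) = (\<Sum>c<?D. complex_of_real (w c * (cmod (ipr (\<phi> c) \<psi>))\<^sup>2))"
    unfolding dec
  proof (subst ipr_msum[OF finite_lessThan _ \<psi> \<psi>])
    show "\<forall>c\<in>{..<?D}. complex_of_real (w c) \<cdot>\<^sub>m outer (\<phi> c) \<in> carrier_mat ?D ?D" using \<phi>c by simp
    have "ipr \<psi> ((complex_of_real (w c) \<cdot>\<^sub>m outer (\<phi> c)) *\<^sub>v \<psi>) = complex_of_real (w c * (cmod (ipr (\<phi> c) \<psi>))\<^sup>2)" for c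
      using outer_form[OF \<phi>c \<psi>, of c] mult_mat_vec_carrier[OF outer_carrier[OF \<phi>c] \<psi>]
      by (simp add: smult_mat_mult_vec[OF outer_carrier[OF \<phi>c] \<psi>] ipr_smult_right[OF \<psi>])
    then show "(\<Sum>c<?D. ipr \<psi> ((complex_of_real (w c) \<cdot>\<^sub>m outer (\<phi> c)) *\<^sub>v \<psi>))
       = (\<Sum>c<?D. complex_of_real (w c * (cmod (ipr (\<phi> c) \<psi>))\<^sup>2))" by simp
  qed
  then have "Re (ipr \<psi> (prod_mat ds \<rho> *\<^sub>v \<psi>)) = (\<Sum>c<?D. w c * (cmod (ipr (\<phi> c) \<psi>))\<^sup>2)" by simp
  also have "\<dots> \<le> (\<Sum>c<?D. w c * Sup (overlaps ds \<psi>))"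
  proof (intro sum_mono mult_left_mono)
    fix c
    have gl: "digit ds l c < ds ! l" if "l < length ds" for l by (rule digit_less[OF ds that])
    then show "w c \<ge> 0" unfolding w_def using nn by (intro prod_nonneg) auto
    have "unit_vec_in (ds ! l) (e l (digit ds l c))" if "l < length ds" for l
      using eigdec_carrier[OF e[OF that] gl[OF that]] orthonormalD(2)[OF eigdecD(1)[OF e[OF that]] gl[OF that] gl[OF that]]
      by (simp add: unit_vec_in_def)
    then have "(cmod (ipr (\<phi> c) \<psi>))\<^sup>2 \<in> overlaps ds \<psi>" by (auto simp: overlaps_def \<phi>_def)
    then show "(cmod (ipr (\<phi> c) \<psi>))\<^sup>2 \<le> Sup (overlaps ds \<psi>)" by (rule cSup_upper[OF _ overlaps_bdd[OF ds \<psi>]])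
  qed
  \<comment> \<open>The total weight factorises into the traces of the local states, all equal to
    1.\<close>
  also have "\<dots> = (\<Prod>l<length ds. \<Sum>k<ds ! l. lam l k) * Sup (overlaps ds \<psi>)"
    by (simp add: w_def sum_distrib_right[symmetric] sum_prod_digits[OF ds])
  also have "\<dots> = Sup (overlaps ds \<psi>)" by (simp add: s1)
  finally show ?thesis .
qed

text \<open>The overlap is linear in \<open>\<omega>\<close>, so the bound for product states
  survives convex combination.\<close>

lemma separable_overlap_le:
  assumes ds: "\<forall>d\<in>set ds. d > 0" and \<psi>: "\<psi> \<in> carrier_vec (dimH ds)" and \<omega>: "separable ds \<omega>"
  shows "Re (ipr \<psi> (\<omega> *\<^sub>v \<psi>)) \<le> Sup (overlaps ds \<psi>)"
proof -
  let ?D = "dimH ds"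
  obtain K :: nat and p \<rho>s where p: "\<forall>j<K. p j \<ge> 0 \<and> (\<forall>l<length ds. density (ds ! l) (\<rho>s j l))"
    and p1: "(\<Sum>j<K. p j) = 1"
    and we: "\<omega> = mat ?D ?D (\<lambda>(a,b). \<Sum>j<K. complex_of_real (p j) * prod_mat ds (\<rho>s j) $$ (a,b))"
    using \<omega> unfolding separable_def by blast
  have "\<omega> = msum ?D {..<K} (\<lambda>j. complex_of_real (p j) \<cdot>\<^sub>m prod_mat ds (\<rho>s j))"
    unfolding we msum_def by (intro cong_mat refl) (auto simp: carrier_matD[OF prod_mat_carrier])
  then have "ipr \<psi> (\<omega> *\<^sub>v \<psi>) = (\<Sum>j<K. ipr \<psi> ((complex_of_real (p j) \<cdot>\<^sub>m prod_mat ds (\<rho>s j)) *\<^sub>v \<psi>))"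
    using \<psi> by (simp add: ipr_msum)
  also have "\<dots> = (\<Sum>j<K. complex_of_real (p j) * ipr \<psi> (prod_mat ds (\<rho>s j) *\<^sub>v \<psi>))"
    by (simp add: smult_mat_mult_vec[OF prod_mat_carrier \<psi>]
        ipr_smult_right[OF \<psi> mult_mat_vec_carrier[OF prod_mat_carrier \<psi>]])
  finally have "Re (ipr \<psi> (\<omega> *\<^sub>v \<psi>)) = (\<Sum>j<K. p j * Re (ipr \<psi> (prod_mat ds (\<rho>s j) *\<^sub>v \<psi>)))" by simp
  also have "\<dots> \<le> (\<Sum>j<K. p j * Sup (overlaps ds \<psi>))"
    using p by (intro sum_mono mult_left_mono product_state_overlap_le[OF ds \<psi>]) auto
  also have "\<dots> = Sup (overlaps ds \<psi>)" using p1 by (simp add: sum_distrib_right[symmetric])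
  finally show ?thesis .
qed

section \<open>Comparison of the three measures\<close>

lemma E_g_le_E_R:
  assumes ds: "\<forall>d\<in>set ds. d > 0" and \<psi>: "unit_vec_in (dimH ds) \<psi>"
  shows "ereal (E_g ds \<psi>) \<le> E_R_pure ds \<psi>"
  unfolding E_R_pure_def E_R_def E_g_eq
  using separable_overlap_le[OF ds] \<psi>
  by (intro INF_greatest rel_ent_pure_ge) (auto simp: unit_vec_in_def)

text \<open>The separable state of the robustness condition is itself the competitor in
  \<open>E_R\<close>: multiplied by \<open>1 + t\<close> it is the projector plus a positive
  operator, which is the domination required by \<open>rel_ent_pure_le\<close>.\<close>

lemma E_R_le_log_rob:
  assumes \<psi>: "unit_vec_in (dimH ds) \<psi>" and t: "t \<in> rob_set ds (outer \<psi>)"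
  shows "E_R_pure ds \<psi> \<le> ereal (log 2 (1 + t))"
proof -
  let ?D = "dimH ds"
  have \<psi>c: "\<psi> \<in> carrier_vec ?D" "ipr \<psi> \<psi> = 1" using \<psi> by (auto simp: unit_vec_in_def)
  obtain \<rho> where t0: "t \<ge> 0" and \<rho>: "density ?D \<rho>"
    and sep: "separable ds (complex_of_real (1 / (1 + t)) \<cdot>\<^sub>m (outer \<psi> + complex_of_real t \<cdot>\<^sub>m \<rho>))"
    using t by (auto simp: rob_set_def)
  define B where "B = outer \<psi> + complex_of_real t \<cdot>\<^sub>m \<rho>"
  define \<omega> where "\<omega> = complex_of_real (1 / (1 + t)) \<cdot>\<^sub>m B"
  have \<rho>': "psd ?D \<rho>" "mtrace \<rho> = 1" "\<rho> \<in> carrier_mat ?D ?D" using \<rho> by (auto simp: density_def psd_def)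
  have o: "psd ?D (outer \<psi>)" using density_outer[OF \<psi>] by (simp add: density_def)
  have B: "psd ?D B" unfolding B_def by (intro psd_add psd_smult o \<rho>' t0)
  have "mtrace B = 1 + complex_of_real t"
    unfolding B_def using \<psi>c \<rho>'
    by (subst mtrace_add[of _ ?D]) (auto simp: mtrace_outer mtrace_smult[of _ ?D])
  then have "mtrace \<omega> = complex_of_real (1 / (1 + t)) * complex_of_real (1 + t)"
    unfolding \<omega>_def by (simp add: mtrace_smult[OF psdD(1)[OF B]])
  also have "\<dots> = complex_of_real (1 / (1 + t) * (1 + t))" by (simp only: of_real_mult)
  also have "\<dots> = 1" using t0 by simp
  finally have \<omega>: "density ?D \<omega>" unfolding density_def using psd_smult[OF B, of "1 / (1 + t)"] t0 by (simp add: \<omega>_def)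
  have "rel_ent ?D (outer \<psi>) \<omega> \<le> ereal (log 2 (1 + t))"
  proof (rule rel_ent_pure_le[OF \<psi> \<omega>])
    fix v :: "complex vec" assume v: "v \<in> carrier_vec ?D"
    have \<rho>v: "\<rho> *\<^sub>v v \<in> carrier_vec ?D" and ov: "outer \<psi> *\<^sub>v v \<in> carrier_vec ?D"
      and Bv: "B *\<^sub>v v \<in> carrier_vec ?D"
      using v \<rho>'(3) outer_carrier[OF \<psi>c(1)] psdD(1)[OF B] by (auto intro: mult_mat_vec_carrier)
    have Be: "B *\<^sub>v v = outer \<psi> *\<^sub>v v + complex_of_real t \<cdot>\<^sub>v (\<rho> *\<^sub>v v)"
      unfolding B_def using v \<rho>'(3) outer_carrier[OF \<psi>c(1)]
      by (simp add: add_mult_distrib_mat_vec[of _ ?D ?D] smult_mat_mult_vec[of _ ?D])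
    have "Re (ipr v (B *\<^sub>v v)) = (cmod (ipr \<psi> v))\<^sup>2 + t * Re (ipr v (\<rho> *\<^sub>v v))"
      unfolding Be using \<rho>v ov v
      by (simp add: ipr_add[of _ ?D] ipr_smult_right[of _ ?D] outer_form[OF \<psi>c(1)])
    then have "(cmod (ipr \<psi> v))\<^sup>2 \<le> Re (ipr v (B *\<^sub>v v))" using psdD(3)[OF \<rho>'(1) v] t0 by simp
    also have "ipr v (B *\<^sub>v v) = complex_of_real (1 + t) * ipr v (\<omega> *\<^sub>v v)"
    proof -
      have "ipr v (\<omega> *\<^sub>v v) = complex_of_real (1 / (1 + t)) * ipr v (B *\<^sub>v v)"
        unfolding \<omega>_def using v Bv by (simp add: smult_mat_mult_vec[OF psdD(1)[OF B] v] ipr_smult_right[of _ ?D])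
      then have "complex_of_real (1 + t) * ipr v (\<omega> *\<^sub>v v)
          = complex_of_real ((1 + t) * (1 / (1 + t))) * ipr v (B *\<^sub>v v)" by (simp only: of_real_mult mult.assoc)
      then show ?thesis using t0 by simp
    qed
    finally show "(cmod (ipr \<psi> v))\<^sup>2 \<le> (1 + t) * Re (ipr v (\<omega> *\<^sub>v v))" by simp
  qed (use t0 in simp)
  then show ?thesis
    unfolding E_R_pure_def E_R_def using sep \<omega> by (intro INF_lower2[of \<omega>]) (auto simp: \<omega>_def B_def)
qed

lemma measures_chain:
  assumes ds: "\<forall>d\<in>set ds. d > 0" and \<psi>: "unit_vec_in (dimH ds) \<psi>"
    and t: "t \<in> rob_set ds (outer \<psi>)"
  shows "rob ds \<psi> \<le> t"
    and "2 powr real_of_ereal (E_R_pure ds \<psi>) \<le> 1 + rob ds \<psi>"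
    and "2 powr E_g ds \<psi> \<le> 2 powr real_of_ereal (E_R_pure ds \<psi>)"
proof -
  show "rob ds \<psi> \<le> t"
    unfolding rob_eq_Inf by (rule cInf_lower[OF t]) (auto simp: rob_set_def intro!: bdd_belowI[of _ 0])
  \<comment> \<open>Finite from below by \<open>E_g\<close> and from above by the feasible
    \<open>t\<close>. Otherwise \<open>real_of_ereal\<close> would return the default value
    0.\<close>
  obtain r where r: "E_R_pure ds \<psi> = ereal r"
    using E_g_le_E_R[OF ds \<psi>] E_R_le_log_rob[OF \<psi> t] by (cases "E_R_pure ds \<psi>") auto
  \<comment> \<open>This bounds every feasible \<open>s\<close>, hence their infimum, whether or not
    it is attained.\<close>
  have "2 powr r - 1 \<le> s" if s: "s \<in> rob_set ds (outer \<psi>)" for s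
  proof -
    have "s \<ge> 0" using s by (auto simp: rob_set_def)
    moreover have "r \<le> log 2 (1 + s)" using E_R_le_log_rob[OF \<psi> s] r by simp
    ultimately show ?thesis by (simp add: le_log_iff)
  qed
  then have "2 powr r - 1 \<le> rob ds \<psi>" unfolding rob_eq_Inf using t by (intro cInf_greatest) auto
  then show "2 powr real_of_ereal (E_R_pure ds \<psi>) \<le> 1 + rob ds \<psi>" using r by simp
  show "2 powr E_g ds \<psi> \<le> 2 powr real_of_ereal (E_R_pure ds \<psi>)"
    using E_g_le_E_R[OF ds \<psi>] r by simp
qed

section \<open>Averages and the dimension bound\<close>

lemma avg_mono: "(\<And>i. i < N \<Longrightarrow> x i \<le> y i) \<Longrightarrow> avg N x \<le> avg N y"
  unfolding avg_def by (intro divide_right_mono sum_mono) auto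

lemma avg_pos: "N > 0 \<Longrightarrow> (\<And>i. i < N \<Longrightarrow> x i > 0) \<Longrightarrow> avg N x > 0"
  unfolding avg_def by (intro divide_pos_pos sum_pos) auto

lemma mtrace_msum: "mtrace (msum n S f) = (\<Sum>j\<in>S. mtrace (f j))"
  if "\<And>j. j \<in> S \<Longrightarrow> f j \<in> carrier_mat n n"
proof -
  have "mtrace (msum n S f) = (\<Sum>j\<in>S. \<Sum>a<n. f j $$ (a,a))"
    by (simp add: mtrace_eq[OF msum_carrier]) (simp add: msum_def sum.swap[of _ S])
  then show ?thesis using mtrace_eq[OF that] by simp
qed

text \<open>The unit vectors in the supports are arbitrary, so a choice maximising the robustness on
  each support is an instance.\<close>

theorem theorem2:
  fixes ds :: "nat list" and N :: nat
    and \<sigma> :: "nat \<Rightarrow> complex mat" and \<psi> :: "nat \<Rightarrow> complex vec"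
  assumes parties: "ds \<noteq> []" "\<forall>d\<in>set ds. d > 0"
    and N_pos: "N > 0"
    and dens: "\<forall>i<N. density (dimH ds) (\<sigma> i)"
    and orth: "\<forall>i<N. \<forall>j<N. i \<noteq> j \<longrightarrow> \<sigma> i * \<sigma> j = 0\<^sub>m (dimH ds) (dimH ds)"
    and locc: "locc_distinguishable ds N \<sigma>"
    and psi: "\<forall>i<N. unit_vec_in (dimH ds) (\<psi> i) \<and> \<psi> i \<in> supp_mat (dimH ds) (\<sigma> i)"
  shows "real N \<le> real (dimH ds) / avg N (\<lambda>i. 1 + rob ds (\<psi> i))
       \<and> real (dimH ds) / avg N (\<lambda>i. 1 + rob ds (\<psi> i))
           \<le> real (dimH ds) / avg N (\<lambda>i. 2 powr real_of_ereal (E_R_pure ds (\<psi> i)))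
       \<and> real (dimH ds) / avg N (\<lambda>i. 2 powr real_of_ereal (E_R_pure ds (\<psi> i)))
           \<le> real (dimH ds) / avg N (\<lambda>i. 2 powr E_g ds (\<psi> i))"
proof -
  let ?D = "dimH ds"
  obtain P where P: "locc_povm ds N P" and dist: "\<forall>i<N. \<forall>j<N. mtrace (P i * \<sigma> j) = (if i = j then 1 else 0)"
    using locc unfolding locc_distinguishable_def by blast
  have eff: "psd ?D (P i)" "sep_cone ds (P i)" if "i < N" for i
    using locc_povm_effects[OF P parties(2)] that by auto
  have complete: "msum ?D {..<N} P = 1\<^sub>m ?D"
    using locc_povm_effects[OF P parties(2)] by simp
  note Pc = psdD(1)[OF eff(1)]
  \<comment> \<open>By completeness, \<open>1 - P i\<close> is the sum of the remaining
    effects.\<close>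
  have compl: "psd ?D (1\<^sub>m ?D - P i)" if "i < N" for i
  proof -
    have "1\<^sub>m ?D = msum ?D (insert i ({..<N} - {i})) P"
      using that complete by (simp add: insert_absorb)
    also have "\<dots> = msum ?D ({..<N} - {i}) P + P i"
      using Pc[OF that] by (intro msum_insert) auto
    finally have "1\<^sub>m ?D - P i = msum ?D ({..<N} - {i}) P"
      using Pc[OF that] by (auto simp: msum_def intro!: eq_matI)
    then show ?thesis using eff(1) by (simp add: psd_msum)
  qed
  have t: "Re (mtrace (P i)) - 1 \<in> rob_set ds (outer (\<psi> i))" if i: "i < N" for i
  proof -
    have "P i *\<^sub>v \<psi> i = \<psi> i"
      using effect_fixes_support[OF Pc[OF i] compl[OF i]] dens dist psi i by auto
    then show ?thesis using effect_trace_in_rob_set[OF parties(2) eff[OF i]] psi i by auto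
  qed
  have u: "unit_vec_in ?D (\<psi> i)" if "i < N" for i using psi that by simp
  note chain = measures_chain[OF parties(2) u t]
  let ?R = "avg N (\<lambda>i. 1 + rob ds (\<psi> i))"
    and ?E = "avg N (\<lambda>i. 2 powr real_of_ereal (E_R_pure ds (\<psi> i)))"
    and ?G = "avg N (\<lambda>i. 2 powr E_g ds (\<psi> i))"
  \<comment> \<open>Positivity of the smallest average passes to the other two, so all denominators
    are positive.\<close>
  have G: "?G > 0" by (rule avg_pos[OF N_pos]) simp
  have GE: "?G \<le> ?E" by (intro avg_mono chain(3))
  have ER: "?E \<le> ?R" by (intro avg_mono chain(2))
  have "real N * ?R = (\<Sum>i<N. 1 + rob ds (\<psi> i))" using N_pos by (simp add: avg_def)
  \<comment> \<open>Each summand obeys \<open>1 + rob \<le> Re (mtrace (P i))\<close>, because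
    \<open>Re (mtrace (P i)) - 1\<close> is feasible.\<close>
  also have "\<dots> \<le> (\<Sum>i<N. Re (mtrace (P i)))"
    using chain(1) by (intro sum_mono) force
  also have "\<dots> = Re (mtrace (msum ?D {..<N} P))" by (subst mtrace_msum) (auto simp: Pc)
  also have "\<dots> = real ?D" unfolding complete by (simp add: mtrace_def)
  finally have "real N * ?R \<le> real ?D" .
  then have "real N \<le> real ?D / ?R" using G GE ER by (simp add: pos_le_divide_eq)
  moreover have "real ?D / ?R \<le> real ?D / ?E" using G GE ER by (intro divide_left_mono) auto
  moreover have "real ?D / ?E \<le> real ?D / ?G" using G GE by (intro divide_left_mono) auto
  ultimately show ?thesis by blast
qed

end
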